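(* Consider the two-type bandit problem with an exogenous arm-reservoir (Model 1) described in the context. The expected cumulative regret of the policy $\pi$ given by Algorithm ALG2 satisfies $$\limsup_{n\to\infty}\frac{\alpha(n)\,\mathbb{E}R_n^{\pi}}{\log n}\leqslant\frac{8}{\Delta\beta_\Delta},$$ where $\beta_\Delta:=\frac{1}{2}\bar{\Phi}(f(T_0))$, with $\bar{\Phi}(v):=\frac{1}{\sqrt{2\pi}}\int_v^\infty e^{-u^2/2}\,du$ for $v>0$, $T_0:=\left\lceil\frac{64}{\Delta^2}\log^2\left(\frac{64}{\Delta^2}\right)\right\rceil$, and $f(x):=x+4\sqrt{x\log x}$ for $x\geqslant1$.
   Context: Bandit problem. There are two arm-types, $\mathcal{K}=\{1,2\}$, with mean rewards $\mu_1>\mu_2$; the gap is $\Delta:=\mu_1-\mu_2>0$. Type 1 is called optimal, type 2 inferior. One arm is played at each time $t\in\{1,\dots,n\}$, where $n$ is the horizon of play. At time $t$ one either replays a previously played arm or plays a new arm queried from the reservoir. An arm queried at time $t$ is of type 1 with probability $\alpha(t)$ and of type 2 otherwise. Types are never observed. The $j$-th pull of arm $i$ yields a $[0,1]$-valued reward $X_{i,j}$ whose mean is $\mu_k$ if arm $i$ has type $k$; rewards are independent across arms and time (for a fixed arm they have a constant mean but need not be identically distributed). $N_i(t)$ denotes the number of pulls of arm $i$ up to time $t$. Regret. For a policy $\pi$ playing arm $\pi_t$ at time $t$, $R_n^{\pi}:=\sum_{t=1}^{n}(\mu_1-X_{\pi_t,N_{\pi_t}(t)})$; $\mathbb{E}R_n^\pi=\mathbb{E}\sum_{t=1}^{n}(\mu_1-\mu_{\kappa(\pi_t)})$,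 where $\kappa(\pi_t)\in\{1,2\}$ is the type of the arm played at time $t$. Expectations are over rewards, policy randomization and reservoir randomness. Exogenous reservoir (Model 1): $(\alpha(t):t=1,2,\dots)$ is a non-increasing deterministic process with $\alpha(1)=c\in(0,1)$, evolving independently of the decision maker's actions. Algorithm ALG2 (Nested UCB). It runs in epochs; within each epoch, $t$ denotes the local time, reset at the start of the epoch, and $N_i(t)$ counts pulls within the epoch. New epoch: at local times 1 and 2, query and play two new arms from the reservoir (call them arms 1 and 2), observing $X_{1,1},X_{2,1}$. Set $m\leftarrow1$ and draw one independent standard Gaussian sample $\mathcal{Z}$ (one sample per epoch). Then for $t=3,4,\dots$: if $\left|\mathcal{Z}+\sum_{j=1}^{m}(X_{1,j}-X_{2,j})\right|<4\sqrt{m\log m}$, permanently discard both arms and start a new epoch; otherwise play an arm $i_t\in\arg\max_{i\in\{1,2\}}\left(\frac{\sum_{j=1}^{N_i(t-1)}X_{i,j}}{N_i(t-1)}+\sqrt{\frac{2\log(t-1)}{N_i(t-1)}}\right)$, observe its reward, and if $m<\min_{i\in\{1,2\}}N_i(t)$ set $m\leftarrow m+1$. The policy does not depend on $n$; it is run for $n$ total plays. *)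

theory Defs
  imports "HOL-Probability.Probability"
begin

text \<open>
  Time starts at 1. At most one arm is queried at each time, so an arm is named by the time at
  which it is queried: arm \<open>i\<close> is the arm that the reservoir supplies at time \<open>i\<close>.
  Rewards are written \<open>x i j\<close> for the \<open>j\<close>-th pull (\<open>j \<ge> 1\<close>) of arm \<open>i\<close>.
\<close>

text \<open>
  The two arms of the epoch that begins at time \<open>s\<close> are the arms \<open>s\<close> and \<open>s + 1\<close>, called
  the first and the second arm below. \<open>pulls1\<close> and \<open>pulls2\<close> are their numbers of pulls,
  so that the local time is \<open>pulls1 + pulls2\<close>. The field \<open>last_arm\<close> is the arm just played.
\<close>

record alg_state =
  epoch_start :: nat
  pulls1 :: nat
  pulls2 :: nat
  mcount :: nat
  last_arm :: nat

definition new_epoch :: "nat \<Rightarrow> alg_state" where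
  "new_epoch t = \<lparr>epoch_start = t, pulls1 = 1, pulls2 = 0, mcount = 0, last_arm = t\<rparr>"

text \<open>Here \<open>N\<close> is the number of pulls before local time \<open>T + 1\<close>.\<close>

definition ucb_index :: "(nat \<Rightarrow> real) \<Rightarrow> nat \<Rightarrow> nat \<Rightarrow> real" where
  "ucb_index r N T = (\<Sum>j=1..N. r j) / real N + sqrt (2 * ln (real T) / real N)"

definition discard_test :: "(nat \<Rightarrow> nat \<Rightarrow> real) \<Rightarrow> real \<Rightarrow> nat \<Rightarrow> nat \<Rightarrow> bool" where
  "discard_test x \<zeta> s m \<longleftrightarrow>
     \<bar>\<zeta> + (\<Sum>j=1..m. x s j - x (s + 1) j)\<bar> < 4 * sqrt (real m * ln (real m))"

definition incr_mcount :: "alg_state \<Rightarrow> alg_state" where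
  "incr_mcount \<sigma> =
     (if mcount \<sigma> < min (pulls1 \<sigma>) (pulls2 \<sigma>) then \<sigma>\<lparr>mcount := mcount \<sigma> + 1\<rparr> else \<sigma>)"

text \<open>
  The play at (global) time \<open>t\<close>. Here \<open>z s\<close> is the Gaussian sample of an epoch that begins at
  time \<open>s\<close>, and \<open>tie\<close> says whether the first arm is played if both UCB indices are equal.
  Ending an epoch takes no time: the first arm of the new epoch is queried and played at time \<open>t\<close>.
  The first branch only serves the initial state.
\<close>

definition alg2_step ::
  "(nat \<Rightarrow> nat \<Rightarrow> real) \<Rightarrow> (nat \<Rightarrow> real) \<Rightarrow> bool \<Rightarrow> nat \<Rightarrow> alg_state \<Rightarrow> alg_state" where
  "alg2_step x z tie t \<sigma> =
     (let s = epoch_start \<sigma>;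
          u1 = ucb_index (x s) (pulls1 \<sigma>) (pulls1 \<sigma> + pulls2 \<sigma>);
          u2 = ucb_index (x (s + 1)) (pulls2 \<sigma>) (pulls1 \<sigma> + pulls2 \<sigma>)
      in if pulls1 \<sigma> = 0 then new_epoch t
         else if pulls2 \<sigma> = 0 then \<sigma>\<lparr>pulls2 := 1, mcount := 1, last_arm := s + 1\<rparr>
         else if discard_test x (z s) s (mcount \<sigma>) then new_epoch t
         else if u1 > u2 \<or> (u1 = u2 \<and> tie)
              then incr_mcount (\<sigma>\<lparr>pulls1 := pulls1 \<sigma> + 1, last_arm := s\<rparr>)
              else incr_mcount (\<sigma>\<lparr>pulls2 := pulls2 \<sigma> + 1, last_arm := s + 1\<rparr>))"

text \<open>
  A history assigns to each past time the arm played, the reward observed, and the Gaussian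
  sample of the epoch. The tie-breaking rule may use the history before the current time; its
  values matter only from local time 3 on, when the Gaussian sample of the epoch has been drawn.
\<close>

type_synonym history = "nat \<Rightarrow> nat \<times> real \<times> real"

definition observe :: "(nat \<Rightarrow> nat \<Rightarrow> real) \<Rightarrow> (nat \<Rightarrow> real) \<Rightarrow> alg_state \<Rightarrow> nat \<times> real \<times> real" where
  "observe x z \<sigma> =
     (last_arm \<sigma>,
      x (last_arm \<sigma>) (if last_arm \<sigma> = epoch_start \<sigma> then pulls1 \<sigma> else pulls2 \<sigma>),
      z (epoch_start \<sigma>))"

primrec alg2_run ::
  "(nat \<Rightarrow> nat \<Rightarrow> real) \<Rightarrow> (nat \<Rightarrow> real) \<Rightarrow> (nat \<Rightarrow> history \<Rightarrow> bool) \<Rightarrow> nat \<Rightarrow> alg_state \<times> history"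
where
  "alg2_run x z tie 0 =
     (\<lparr>epoch_start = 0, pulls1 = 0, pulls2 = 0, mcount = 0, last_arm = 0\<rparr>, \<lambda>_. (0, 0, 0))"
| "alg2_run x z tie (Suc t) =
     (let (\<sigma>, h) = alg2_run x z tie t;
          \<sigma>' = alg2_step x z (tie (Suc t) h) (Suc t) \<sigma>
      in (\<sigma>', h(Suc t := observe x z \<sigma>')))"

definition alg2_arm ::
  "(nat \<Rightarrow> nat \<Rightarrow> real) \<Rightarrow> (nat \<Rightarrow> real) \<Rightarrow> (nat \<Rightarrow> history \<Rightarrow> bool) \<Rightarrow> nat \<Rightarrow> nat" where
  "alg2_arm x z tie t = last_arm (fst (alg2_run x z tie t))"

definition num_pulls :: "(nat \<Rightarrow> nat) \<Rightarrow> nat \<Rightarrow> nat \<Rightarrow> nat" where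
  "num_pulls p i t = card {s \<in> {1..t}. p s = i}"

definition regret :: "real \<Rightarrow> (nat \<Rightarrow> nat \<Rightarrow> real) \<Rightarrow> (nat \<Rightarrow> nat) \<Rightarrow> nat \<Rightarrow> real" where
  "regret \<mu>1 x p n = (\<Sum>t=1..n. \<mu>1 - x (p t) (num_pulls p (p t) t))"

text \<open>
  \<open>\<kappa> i\<close> is the type of arm \<open>i\<close>, and \<open>Y k i j\<close> is the reward of the \<open>j\<close>-th pull of arm \<open>i\<close> if
  that arm has type \<open>k\<close>. Thus the laws of rewards may depend on type, arm and pull.
\<close>

definition rewards ::
  "(nat \<Rightarrow> 'a \<Rightarrow> nat) \<Rightarrow> (nat \<Rightarrow> nat \<Rightarrow> nat \<Rightarrow> 'a \<Rightarrow> real) \<Rightarrow> 'a \<Rightarrow> nat \<Rightarrow> nat \<Rightarrow> real" where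
  "rewards \<kappa> Y \<omega> i j = Y (\<kappa> i \<omega>) i j \<omega>"

datatype source = Type_of nat | Reward_of nat nat nat | Gauss nat | Seed

definition sources :: "source set" where
  "sources = {Type_of i | i. i \<ge> 1} \<union> {Reward_of k i j | k i j. k \<in> {1, 2} \<and> i \<ge> 1 \<and> j \<ge> 1}
           \<union> {Gauss i | i. i \<ge> 1} \<union> {Seed}"

primrec source_var ::
  "(nat \<Rightarrow> 'a \<Rightarrow> nat) \<Rightarrow> (nat \<Rightarrow> nat \<Rightarrow> nat \<Rightarrow> 'a \<Rightarrow> real) \<Rightarrow> (nat \<Rightarrow> 'a \<Rightarrow> real) \<Rightarrow> ('a \<Rightarrow> real)
   \<Rightarrow> source \<Rightarrow> 'a \<Rightarrow> real"
where
  "source_var \<kappa> Y Z U (Type_of i) = (\<lambda>\<omega>. real (\<kappa> i \<omega>))"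
| "source_var \<kappa> Y Z U (Reward_of k i j) = Y k i j"
| "source_var \<kappa> Y Z U (Gauss i) = Z i"
| "source_var \<kappa> Y Z U Seed = U"

text \<open>
  \<open>U\<close> is the private randomization of the tie-breaking rule \<open>tie\<close>; its law is arbitrary.
\<close>

locale alg2_bandit = prob_space M
  for M :: "'a measure" +
  fixes \<mu> :: "nat \<Rightarrow> real"
    and \<alpha> :: "nat \<Rightarrow> real"
    and \<kappa> :: "nat \<Rightarrow> 'a \<Rightarrow> nat"
    and Y :: "nat \<Rightarrow> nat \<Rightarrow> nat \<Rightarrow> 'a \<Rightarrow> real"
    and Z :: "nat \<Rightarrow> 'a \<Rightarrow> real"
    and U :: "'a \<Rightarrow> real"
    and tie :: "nat \<Rightarrow> history \<Rightarrow> real \<Rightarrow> bool"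
  assumes gap: "\<mu> 1 > \<mu> 2"
    and reservoir_start: "0 < \<alpha> 1" "\<alpha> 1 < 1"
    and reservoir_decreasing: "\<And>t. t \<ge> 1 \<Longrightarrow> \<alpha> (t + 1) \<le> \<alpha> t"
    and arm_types: "\<And>i \<omega>. i \<ge> 1 \<Longrightarrow> \<omega> \<in> space M \<Longrightarrow> \<kappa> i \<omega> \<in> {1, 2}"
    and arm_type_prob: "\<And>i. i \<ge> 1 \<Longrightarrow> prob {\<omega> \<in> space M. \<kappa> i \<omega> = 1} = \<alpha> i"
    and reward_range: "\<And>k i j \<omega>. k \<in> {1, 2} \<Longrightarrow> i \<ge> 1 \<Longrightarrow> j \<ge> 1 \<Longrightarrow> \<omega> \<in> space M \<Longrightarrow> Y k i j \<omega> \<in> {0..1}"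
    and reward_mean: "\<And>k i j. k \<in> {1, 2} \<Longrightarrow> i \<ge> 1 \<Longrightarrow> j \<ge> 1 \<Longrightarrow> expectation (Y k i j) = \<mu> k"
    and gauss: "\<And>i. i \<ge> 1 \<Longrightarrow> distributed M lborel (Z i) std_normal_density"
    and independent: "indep_vars (\<lambda>_. borel) (source_var \<kappa> Y Z U) sources"
    and tie_measurable: "\<And>t. (\<lambda>(h, u). tie t h u) \<in> measurable
          ((\<Pi>\<^sub>M s\<in>UNIV. count_space UNIV \<Otimes>\<^sub>M borel \<Otimes>\<^sub>M borel) \<Otimes>\<^sub>M borel) (count_space UNIV)"

definition alg2_regret ::
  "(nat \<Rightarrow> real) \<Rightarrow> (nat \<Rightarrow> 'a \<Rightarrow> nat) \<Rightarrow> (nat \<Rightarrow> nat \<Rightarrow> nat \<Rightarrow> 'a \<Rightarrow> real) \<Rightarrow> (nat \<Rightarrow> 'a \<Rightarrow> real)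
   \<Rightarrow> ('a \<Rightarrow> real) \<Rightarrow> (nat \<Rightarrow> history \<Rightarrow> real \<Rightarrow> bool) \<Rightarrow> nat \<Rightarrow> 'a \<Rightarrow> real" where
  "alg2_regret \<mu> \<kappa> Y Z U tie n \<omega> =
     (let x = rewards \<kappa> Y \<omega>
      in regret (\<mu> 1) x (alg2_arm x (\<lambda>i. Z i \<omega>) (\<lambda>t h. tie t h (U \<omega>))) n)"

definition Phi_bar :: "real \<Rightarrow> real" where
  "Phi_bar v = 1 / sqrt (2 * pi) * (LBINT u:{v..}. exp (- u\<^sup>2 / 2))"

definition bound_f :: "real \<Rightarrow> real" where
  "bound_f x = x + 4 * sqrt (x * ln x)"

definition T0 :: "real \<Rightarrow> int" where
  "T0 \<Delta> = \<lceil>64 / \<Delta>\<^sup>2 * (ln (64 / \<Delta>\<^sup>2))\<^sup>2\<rceil>"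

definition beta :: "real \<Rightarrow> real" where
  "beta \<Delta> = 1 / 2 * Phi_bar (bound_f (real_of_int (T0 \<Delta>)))"

end

(*
A pair of arms of different types survives all tests with probability at least beta. Up to the
m-value T0 a Gaussian sample of modulus at least f(T0) and of the right sign suffices, since m
differences of rewards have modulus at most m; beyond T0 the drift m Delta exceeds 8 sqrt(m log m),
so by Hoeffding's inequality the test is never met with probability at least 1/2. An epoch depends on
the past only through the fact that it starts, so the expected number of mixed epochs is at most
1/beta, and each costs at most 8 log n / Delta^2 + O(1) inferior pulls by the usual analysis of UCB.
Two inferior arms fail the test after O(1) comparisons on average, and UCB with equal means keeps the
numbers of pulls within a constant factor of each other, so such an epoch has expected length O(1).
Because alpha decreases, a pair of inferior arms is at most 1/(2 alpha(n)) times as likely as a mixed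
pair. Hence alpha(n) times the number of inferior pulls is at most
8 log n / (Delta^2 beta) + O(1).
*)
theory Submission
  imports Defs
begin

section \<open>Runs of the algorithm\<close>

text \<open>The regret is defined through observed rewards, at random positions (arm, number of the
  pull). Conditioning along the run is avoided: every random object is a function of a set of
  independent sources, and each product formula comes from two disjoint index sets. For the regret,
  the event that arm \<open>i\<close> is pulled at least \<open>j\<close> times is separated from
  the \<open>j\<close>-th reward of \<open>i\<close>, which reduces the expectation to inferior
  plays. For an epoch at \<open>s\<close>, three blocks are separated: what decides that it starts,
  the types of its two arms, and their rewards with the Gaussian sample. The obstacle is that the
  plays in an epoch also depend on tie-breaking and on the horizon. They are therefore dominated
  pathwise by counts over all local times and all test sizes up to \<open>n\<close>, reached or not,
  which involve only the last block. The number of mixed epochs needs no geometric law: the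
  probabilities of disjoint survival events add up to at most 1. An epoch that begins at time
  \<open>n\<close> itself is treated apart, since its second arm has the type law of time
  \<open>n + 1\<close>, where \<alpha> may already be smaller than at \<open>n\<close>.\<close>

lemma num_pulls_0 [simp]: "num_pulls p i 0 = 0"
  by (simp add: num_pulls_def)

lemma num_pulls_Suc: "num_pulls p i (Suc t) = num_pulls p i t + of_bool (p (Suc t) = i)"
proof -
  have "{s \<in> {1..Suc t}. p s = i} = (if p (Suc t) = i then insert (Suc t) {s \<in> {1..t}. p s = i}
      else {s \<in> {1..t}. p s = i})"
    by (auto simp: le_Suc_eq)
  then show ?thesis
    by (simp add: num_pulls_def)
qed

lemma num_pulls_mono: "s \<le> t \<Longrightarrow> num_pulls p i s \<le> num_pulls p i t"
  by (induction t rule: dec_induct) (auto simp: num_pulls_Suc)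

lemma num_pulls_le: "num_pulls p i t \<le> t"
  by (induction t) (auto simp: num_pulls_Suc)

text \<open>Time \<open>t\<close> contributes exactly the term for the newest pull of its arm, so
  the double sum grows by that one term. The regrouping turns random positions into fixed pairs, to
  which independence can be applied.\<close>

lemma sum_over_pulls:
  fixes g :: "nat \<Rightarrow> nat \<Rightarrow> real"
  assumes "finite I" "\<And>t. 1 \<le> t \<Longrightarrow> t \<le> n \<Longrightarrow> p t \<in> I"
  shows "(\<Sum>t=1..n. g (p t) (num_pulls p (p t) t)) = (\<Sum>i\<in>I. \<Sum>j=1..num_pulls p i n. g i j)"
  using assms(2)
proof (induction n)
  case (Suc n)
  have p: "p (Suc n) \<in> I" using Suc.prems by simp
  have "(\<Sum>i\<in>I. \<Sum>j=1..num_pulls p i (Suc n). g i j)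
      = (\<Sum>i\<in>I. (\<Sum>j=1..num_pulls p i n. g i j) + (if p (Suc n) = i then g i (Suc (num_pulls p i n)) else 0))"
    by (intro sum.cong) (auto simp: num_pulls_Suc)
  also have "\<dots> = (\<Sum>i\<in>I. \<Sum>j=1..num_pulls p i n. g i j) + g (p (Suc n)) (Suc (num_pulls p (p (Suc n)) n))"
    using p assms(1) by (simp add: sum.distrib)
  finally show ?case using Suc by (simp add: num_pulls_Suc)
qed simp

text \<open>A pull of \<open>b\<close> raises its number of pulls, so each value is attained before at most one pull.\<close>

lemma card_pulls_le:
  assumes "finite W" and W: "\<And>t. t \<in> W \<Longrightarrow> p (Suc t) = b \<and> 1 \<le> num_pulls p b t \<and> real (num_pulls p b t) \<le> L"
    and "0 \<le> L"
  shows "real (card W) \<le> L"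
proof -
  have "inj_on (num_pulls p b) W"
  proof (rule linorder_inj_onI)
    fix s t assume st: "s < t" "s \<in> W" "t \<in> W"
    have "num_pulls p b s < num_pulls p b (Suc s)"
      using W[OF st(2)] by (simp add: num_pulls_Suc)
    also have "\<dots> \<le> num_pulls p b t"
      using st by (intro num_pulls_mono) simp
    finally show "num_pulls p b s \<noteq> num_pulls p b t" by simp
  qed auto
  moreover have "num_pulls p b ` W \<subseteq> {1..nat \<lfloor>L\<rfloor>}"
    using W by (auto simp: le_nat_floor)
  ultimately have "card W \<le> card {1..nat \<lfloor>L\<rfloor>}"
    by (intro card_inj_on_le) auto
  then show ?thesis using \<open>0 \<le> L\<close> by (simp add: le_nat_iff le_floor_iff)
qed

text \<open>The averages and the test read only rewards that have already been observed; for the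
  test this is ensured by \<open>mcount\<close> being at most both counts. The sample matters only
  once both arms have been pulled. The later statements on what a whole run reads rest on
  this.\<close>

lemma alg2_step_cong:
  assumes "\<And>j. 1 \<le> j \<Longrightarrow> j \<le> pulls1 \<sigma> \<Longrightarrow> x (epoch_start \<sigma>) j = x' (epoch_start \<sigma>) j"
    and "\<And>j. 1 \<le> j \<Longrightarrow> j \<le> pulls2 \<sigma> \<Longrightarrow> x (epoch_start \<sigma> + 1) j = x' (epoch_start \<sigma> + 1) j"
    and "0 < pulls1 \<sigma> \<Longrightarrow> 0 < pulls2 \<sigma> \<Longrightarrow> z (epoch_start \<sigma>) = z' (epoch_start \<sigma>)"
    and "mcount \<sigma> \<le> pulls1 \<sigma>" "mcount \<sigma> \<le> pulls2 \<sigma>"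
  shows "alg2_step x z b t \<sigma> = alg2_step x' z' b t \<sigma>"
proof -
  let ?s = "epoch_start \<sigma>"
  have 1: "(\<Sum>j=1..pulls1 \<sigma>. x ?s j) = (\<Sum>j=1..pulls1 \<sigma>. x' ?s j)"
    using assms(1) by (intro sum.cong) auto
  have 2: "(\<Sum>j=1..pulls2 \<sigma>. x (?s + 1) j) = (\<Sum>j=1..pulls2 \<sigma>. x' (?s + 1) j)"
    using assms(2) by (intro sum.cong) auto
  have 3: "(\<Sum>j=1..mcount \<sigma>. x ?s j - x (?s + 1) j) = (\<Sum>j=1..mcount \<sigma>. x' ?s j - x' (?s + 1) j)"
    using assms by (intro sum.cong) auto
  show ?thesis
    using assms(3) unfolding alg2_step_def ucb_index_def discard_test_def Let_def 1 2 3 by auto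
qed

text \<open>Both play cases keep only the weak inequality between the indices, so the tie-breaking
  rule disappears from every argument by these cases.\<close>

lemma alg2_step_cases [consumes 2, case_names second new play1 play2]:
  fixes x z tie t \<sigma> \<sigma>'
  defines "s \<equiv> epoch_start \<sigma>" and "T \<equiv> pulls1 \<sigma> + pulls2 \<sigma>"
  assumes "pulls1 \<sigma> \<noteq> 0" and step: "\<sigma>' = alg2_step x z tie t \<sigma>"
  obtains
    (second) "pulls2 \<sigma> = 0" "\<sigma>' = \<sigma>\<lparr>pulls2 := 1, mcount := 1, last_arm := Suc s\<rparr>"
  | (new) "pulls2 \<sigma> \<noteq> 0" "discard_test x (z s) s (mcount \<sigma>)" "\<sigma>' = new_epoch t"
  | (play1) "pulls2 \<sigma> \<noteq> 0" "\<not> discard_test x (z s) s (mcount \<sigma>)"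
      "ucb_index (x (Suc s)) (pulls2 \<sigma>) T \<le> ucb_index (x s) (pulls1 \<sigma>) T"
      "\<sigma>' = incr_mcount (\<sigma>\<lparr>pulls1 := Suc (pulls1 \<sigma>), last_arm := s\<rparr>)"
  | (play2) "pulls2 \<sigma> \<noteq> 0" "\<not> discard_test x (z s) s (mcount \<sigma>)"
      "ucb_index (x s) (pulls1 \<sigma>) T \<le> ucb_index (x (Suc s)) (pulls2 \<sigma>) T"
      "\<sigma>' = incr_mcount (\<sigma>\<lparr>pulls2 := Suc (pulls2 \<sigma>), last_arm := Suc s\<rparr>)"
proof -
  define u1 u2 where "u1 = ucb_index (x s) (pulls1 \<sigma>) T" and "u2 = ucb_index (x (Suc s)) (pulls2 \<sigma>) T"
  have eq: "alg2_step x z tie t \<sigma> = (if pulls2 \<sigma> = 0 then \<sigma>\<lparr>pulls2 := 1, mcount := 1, last_arm := Suc s\<rparr>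
      else if discard_test x (z s) s (mcount \<sigma>) then new_epoch t
      else if u1 > u2 \<or> (u1 = u2 \<and> tie)
        then incr_mcount (\<sigma>\<lparr>pulls1 := Suc (pulls1 \<sigma>), last_arm := s\<rparr>)
        else incr_mcount (\<sigma>\<lparr>pulls2 := Suc (pulls2 \<sigma>), last_arm := Suc s\<rparr>))"
    using assms by (simp add: alg2_step_def Let_def u1_def u2_def s_def T_def)
  show thesis
    using second new play1 play2 unfolding u1_def[symmetric] u2_def[symmetric] step eq
    by (cases "pulls2 \<sigma> = 0"; cases "discard_test x (z s) s (mcount \<sigma>)";
        cases "u1 > u2 \<or> (u1 = u2 \<and> tie)") auto
qed

section \<open>The invariant linking the state to the numbers of pulls\<close>

definition state_inv ::
  "(nat \<Rightarrow> nat \<Rightarrow> real) \<Rightarrow> (nat \<Rightarrow> real) \<Rightarrow> nat \<Rightarrow> (nat \<Rightarrow> nat) \<Rightarrow> alg_state \<Rightarrow> bool" where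
  "state_inv x z t N \<sigma> \<longleftrightarrow>
     (case (epoch_start \<sigma>, pulls1 \<sigma>, pulls2 \<sigma>, mcount \<sigma>, last_arm \<sigma>) of (s, a, b, m, l) \<Rightarrow>
       1 \<le> s \<and> s \<le> t \<and> 1 \<le> a \<and> (b = 0 \<longrightarrow> s = t) \<and> s + a + b = Suc t \<and> m = min a b \<and>
       (l = s \<or> l = Suc s \<and> 1 \<le> b) \<and> N s = a \<and> N (Suc s) = b \<and> (\<forall>i > Suc s. N i = 0) \<and>
       (\<forall>k. 1 \<le> k \<longrightarrow> k < m \<longrightarrow> \<not> discard_test x (z s) s k))"

text \<open>The arms of a new epoch have never been pulled, so global numbers of pulls agree with
  counts within the epoch; the invariant secures this by \<open>N i = 0\<close> beyond
  \<open>Suc s\<close>. Only tests with \<open>k < m\<close> are recorded as passed, because the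
  test at \<open>m\<close> itself may still be pending.\<close>

lemma state_inv_step:
  assumes inv: "state_inv x z t N \<sigma>" and \<sigma>': "\<sigma>' = alg2_step x z tie (Suc t) \<sigma>"
  shows "state_inv x z (Suc t) (\<lambda>i. N i + of_bool (last_arm \<sigma>' = i)) \<sigma>'"
proof -
  obtain s a b m l where \<sigma>: "\<sigma> = \<lparr>epoch_start = s, pulls1 = a, pulls2 = b, mcount = m, last_arm = l\<rparr>"
    by (cases \<sigma>)
  have s: "1 \<le> s" "s \<le> t" "1 \<le> a" "b = 0 \<Longrightarrow> s = t" "s + a + b = Suc t" and m: "m = min a b"
    and N: "N s = a" "N (Suc s) = b" "\<And>i. i > Suc s \<Longrightarrow> N i = 0"
    and D: "\<And>k. 1 \<le> k \<Longrightarrow> k < m \<Longrightarrow> \<not> discard_test x (z s) s k"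
    using inv by (auto simp: state_inv_def \<sigma>)
  have a0: "a \<noteq> 0" using s by simp
  have nz: "pulls1 \<sigma> \<noteq> 0" using a0 by (simp add: \<sigma>)
  show ?thesis
    using nz \<sigma>'
  proof (cases rule: alg2_step_cases)
    case second
    show ?thesis unfolding second(2) using s N second(1) by (auto simp: state_inv_def \<sigma>)
  next
    case new
    \<comment> \<open>Discarding requires both arms to have been pulled, so the arm named
      \<open>Suc t\<close> is neither \<open>s\<close> nor \<open>Suc s\<close> and is
      fresh.\<close>
    have "Suc s < Suc t" using s(5) a0 new(1) by (simp add: \<sigma>)
    then show ?thesis unfolding new(3) using s N by (simp add: state_inv_def new_epoch_def)
  next
    case play1
    have D': "\<not> discard_test x (z s) s k" if "1 \<le> k" "k < min (Suc a) b" for k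
    proof -
      have "k < m \<or> k = m" using that(2) m by auto
      then show ?thesis using D[of k] play1(2) that(1) by (auto simp: \<sigma>)
    qed
    show ?thesis unfolding play1(4) using s N D' m play1(1)
      by (simp add: state_inv_def incr_mcount_def \<sigma>) linarith
  next
    case play2
    have D': "\<not> discard_test x (z s) s k" if "1 \<le> k" "k < min a (Suc b)" for k
    proof -
      have "k < m \<or> k = m" using that(2) m by auto
      then show ?thesis using D[of k] play2(2) that(1) by (auto simp: \<sigma>)
    qed
    show ?thesis unfolding play2(4) using s N D' m play2(1)
      by (simp add: state_inv_def incr_mcount_def \<sigma>) linarith
  qed
qed

context
  fixes x :: "nat \<Rightarrow> nat \<Rightarrow> real" and z :: "nat \<Rightarrow> real" and tie :: "nat \<Rightarrow> history \<Rightarrow> bool"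
begin

abbreviation "st t \<equiv> fst (alg2_run x z tie t)"
abbreviation "ep t \<equiv> epoch_start (st t)"
abbreviation "arm \<equiv> alg2_arm x z tie"

lemma st_Suc:
  "st (Suc t) = alg2_step x z (tie (Suc t) (snd (alg2_run x z tie t))) (Suc t) (st t)"
  by (simp add: case_prod_unfold Let_def)

lemma snd_run_Suc:
  "snd (alg2_run x z tie (Suc t)) = (snd (alg2_run x z tie t))(Suc t := observe x z (st (Suc t)))"
  by (simp add: case_prod_unfold Let_def)

lemma st_1: "st (Suc 0) = new_epoch (Suc 0)"
  by (simp add: alg2_step_def Let_def)

lemma arm_eq: "arm t = last_arm (st t)"
  by (simp add: alg2_arm_def)

lemma state_inv_run: "1 \<le> t \<Longrightarrow> state_inv x z t (\<lambda>i. num_pulls arm i t) (st t)"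
proof (induction t rule: nat_induct_at_least)
  case base
  show ?case unfolding One_nat_def st_1
    using st_1 by (auto simp: state_inv_def new_epoch_def num_pulls_Suc alg2_arm_def)
next
  case (Suc t)
  show ?case
    using state_inv_step[OF Suc.IH st_Suc] unfolding num_pulls_Suc arm_eq .
qed

lemma
  assumes "1 \<le> t"
  shows ep_bounds: "1 \<le> ep t" "ep t \<le> t"
    and mcount_eq: "mcount (st t) = min (num_pulls arm (ep t) t) (num_pulls arm (Suc (ep t)) t)"
    and pulls_eq: "pulls1 (st t) = num_pulls arm (ep t) t" "pulls2 (st t) = num_pulls arm (Suc (ep t)) t"
    and pulls_pos: "1 \<le> num_pulls arm (ep t) t" "num_pulls arm (Suc (ep t)) t = 0 \<Longrightarrow> ep t = t"
    and pulls_sum: "ep t + num_pulls arm (ep t) t + num_pulls arm (Suc (ep t)) t = Suc t"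
    and arm_cases: "arm t = ep t \<or> arm t = Suc (ep t) \<and> 1 \<le> num_pulls arm (Suc (ep t)) t"
    and not_discarded: "1 \<le> m \<Longrightarrow> m < mcount (st t) \<Longrightarrow> \<not> discard_test x (z (ep t)) (ep t) m"
  using state_inv_run[OF assms] unfolding state_inv_def prod.case arm_eq by (elim conjE; simp)+

lemma arm_bounds: "1 \<le> t \<Longrightarrow> 1 \<le> arm t \<and> arm t \<le> t"
  using arm_cases[of t] ep_bounds[of t] pulls_sum[of t] pulls_pos(1)[of t] by linarith

lemma arm_pulls:
  assumes "1 \<le> t"
  shows "(if arm t = ep t then pulls1 (st t) else pulls2 (st t)) = num_pulls arm (arm t) t"
    and "1 \<le> num_pulls arm (arm t) t"
  using arm_cases[OF assms] pulls_eq[OF assms] pulls_pos[OF assms] by auto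

lemma ep_Suc: "1 \<le> t \<Longrightarrow> ep (Suc t) = ep t \<or> ep (Suc t) = Suc t"
  unfolding st_Suc by (simp add: alg2_step_def Let_def new_epoch_def incr_mcount_def)

text \<open>The epoch start either stays or jumps to the current time, so once it exceeds
  \<open>u\<close> it can never return to a value \<open>s\<close> below or at
  \<open>u\<close>.\<close>

lemma ep_const:
  assumes "ep t = s" "1 \<le> s" "s \<le> u" "u \<le> t"
  shows "ep u = s"
proof -
  have "ep v = ep u \<or> u < ep v" if "u \<le> v" for v
    using that
  proof (induction v rule: dec_induct)
    case (step v)
    then show ?case using ep_Suc[of v] assms by auto
  qed simp
  from this[of t] show ?thesis using assms by auto
qed

text \<open>Here \<open>b\<close> is the arm just played, in either position, so that the inferior
  arm may come first or second. The passed tests include the one at the current count: this play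
  took place only because that test was passed, whereas the invariant covers only the smaller
  ones.\<close>

lemma epoch_play:
  assumes t: "ep t = s" "s < t" and s: "ep (Suc t) = s" "1 \<le> s"
    and ab: "arm (Suc t) = b" "{a, b} = {s, Suc s}"
  shows "ucb_index (x a) (num_pulls arm a t) (Suc t - s) \<le> ucb_index (x b) (num_pulls arm b t) (Suc t - s)"
    and "1 \<le> num_pulls arm a t" "1 \<le> num_pulls arm b t" "num_pulls arm a t + num_pulls arm b t = Suc t - s"
    and "1 \<le> m \<Longrightarrow> m \<le> min (num_pulls arm a t) (num_pulls arm b t) \<Longrightarrow> \<not> discard_test x (z s) s m"
proof -
  have t1: "1 \<le> t" using t by simp
  note f = mcount_eq[OF t1] pulls_eq[OF t1] pulls_sum[OF t1] pulls_pos[OF t1]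
  have p: "1 \<le> num_pulls arm s t" "1 \<le> num_pulls arm (Suc s) t"
    "num_pulls arm s t + num_pulls arm (Suc s) t = Suc t - s"
    using f t by (auto simp: Suc_le_eq)
  have ab': "a = s \<and> b = Suc s \<or> a = Suc s \<and> b = s" using ab(2) by (metis doubleton_eq_iff)
  show "1 \<le> num_pulls arm a t" "1 \<le> num_pulls arm b t" "num_pulls arm a t + num_pulls arm b t = Suc t - s"
    using p ab' by auto
  have nz: "pulls1 (st t) \<noteq> 0" using p f t by simp
  have "\<not> discard_test x (z s) s (mcount (st t)) \<and>
     ucb_index (x a) (num_pulls arm a t) (Suc t - s) \<le> ucb_index (x b) (num_pulls arm b t) (Suc t - s)"
    using nz st_Suc
  proof (cases rule: alg2_step_cases)
    case second
    then show ?thesis using p f t by simp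
  next
    case new
    then have "ep (Suc t) = Suc t" unfolding new(3) by (simp add: new_epoch_def)
    then show ?thesis using s t by simp
  next
    case play1
    have "arm (Suc t) = s" unfolding arm_eq play1(4) using t by (simp add: incr_mcount_def)
    then show ?thesis using play1 ab' ab(1) f p t by simp
  next
    case play2
    have "arm (Suc t) = Suc s" unfolding arm_eq play2(4) using t by (simp add: incr_mcount_def)
    then show ?thesis using play2 ab' ab(1) f p t by simp
  qed
  then show "ucb_index (x a) (num_pulls arm a t) (Suc t - s) \<le> ucb_index (x b) (num_pulls arm b t) (Suc t - s)"
    and "1 \<le> m \<Longrightarrow> m \<le> min (num_pulls arm a t) (num_pulls arm b t) \<Longrightarrow> \<not> discard_test x (z s) s m"
    using not_discarded[OF t1, of m] f(1) t ab' by (auto simp: min.commute le_less)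
qed

lemma epoch_forever:
  assumes "ep s = s" "1 \<le> s" "\<And>m. 1 \<le> m \<Longrightarrow> \<not> discard_test x (z s) s m" "s \<le> t"
  shows "ep t = s"
  using assms(4)
proof (induction t rule: dec_induct)
  case (step t)
  have t1: "1 \<le> t" using assms step by simp
  note f = mcount_eq[OF t1] pulls_eq[OF t1] pulls_pos[OF t1]
  have nz: "pulls1 (st t) \<noteq> 0" using f by simp
  show ?case
    using nz st_Suc
  proof (cases rule: alg2_step_cases)
    case second
    show ?thesis unfolding second(2) using step by simp
  next
    case new
    have "1 \<le> mcount (st t)" using f new(1) step.IH by simp
    then show ?thesis using new(2) assms(3) step by simp
  next
    case play1
    show ?thesis unfolding play1(4) using step by (simp add: incr_mcount_def)
  next
    case play2
    show ?thesis unfolding play2(4) using step by (simp add: incr_mcount_def)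
  qed
qed (use assms in simp)

end

section \<open>Which rewards and samples a run reads\<close>

lemma alg2_step_agree:
  assumes "1 \<le> t"
    and "\<And>i j. 1 \<le> j \<Longrightarrow> j \<le> num_pulls (alg2_arm x z tie) i t \<Longrightarrow> 1 \<le> i \<Longrightarrow> i \<le> t \<Longrightarrow> x i j = x' i j"
    and "\<And>i. 1 \<le> i \<Longrightarrow> i \<le> t \<Longrightarrow> z i = z' i"
  shows "alg2_step x z b u (fst (alg2_run x z tie t)) = alg2_step x' z' b u (fst (alg2_run x z tie t))"
proof -
  note f = pulls_eq[OF assms(1), of x z tie] ep_bounds[OF assms(1), of x z tie]
    pulls_sum[OF assms(1), of x z tie] pulls_pos(1)[OF assms(1), of x z tie] mcount_eq[OF assms(1), of x z tie]
  show ?thesis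
    by (rule alg2_step_cong; (rule assms)?) (use f in simp_all)
qed

text \<open>The state runs one step ahead of the history: the arm at \<open>Suc t\<close> is chosen
  before any reward or sample indexed by \<open>Suc t\<close> is read, while the history entry at
  \<open>Suc t\<close> may contain one. This extra step makes the start of an epoch at a given time
  a matter of strictly smaller indices.\<close>

lemma alg2_run_cong:
  assumes "\<And>i j. 1 \<le> i \<Longrightarrow> i \<le> t \<Longrightarrow> 1 \<le> j \<Longrightarrow> x i j = x' i j"
    and "\<And>i. 1 \<le> i \<Longrightarrow> i \<le> t \<Longrightarrow> z i = z' i"
  shows "alg2_run x z tie t = alg2_run x' z' tie t \<and>
    fst (alg2_run x z tie (Suc t)) = fst (alg2_run x' z' tie (Suc t))"
  using assms
proof (induction t)
  case 0
  show ?case using st_1[of x z tie] st_1[of x' z' tie] by simp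
next
  case (Suc t)
  note f = Suc.IH[OF Suc.prems]
  have eq: "alg2_run x z tie t = alg2_run x' z' tie t"
    and st: "fst (alg2_run x z tie (Suc t)) = fst (alg2_run x' z' tie (Suc t))"
    using f by auto
  have "observe x z (fst (alg2_run x z tie (Suc t))) = observe x' z' (fst (alg2_run x z tie (Suc t)))"
    using arm_pulls[of "Suc t" x z tie] arm_bounds[of "Suc t" x z tie] ep_bounds[of "Suc t" x z tie] Suc.prems
    unfolding observe_def arm_eq by simp
  then have eq': "alg2_run x z tie (Suc t) = alg2_run x' z' tie (Suc t)"
    using st eq by (intro prod_eqI) (simp_all only: snd_run_Suc)
  have "alg2_step x z b u (fst (alg2_run x z tie (Suc t))) = alg2_step x' z' b u (fst (alg2_run x z tie (Suc t)))" for b u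
    by (rule alg2_step_agree) (use Suc.prems in auto)
  then have "fst (alg2_run x z tie (Suc (Suc t))) = fst (alg2_run x' z' tie (Suc (Suc t)))"
    by (simp only: st_Suc eq')
  with eq' show ?case by blast
qed

text \<open>Both runs coincide until the \<open>j\<close>-th pull of arm \<open>i\<close> and still
  choose the same arm at that pull, since its reward is seen only afterwards. From then on they may
  differ, but both numbers of pulls stay at least \<open>j\<close>; hence the alternative carried
  through the induction.\<close>

lemma pulls_insensitive:
  fixes x x' z tie i j
  defines "p \<equiv> alg2_arm x z tie" and "q \<equiv> alg2_arm x' z tie"
  assumes x': "\<And>i' j'. (i', j') \<noteq> (i, j) \<Longrightarrow> x i' j' = x' i' j'"
  shows "j \<le> num_pulls p i t \<longleftrightarrow> j \<le> num_pulls q i t"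
proof -
  let ?R = "alg2_run x z tie" and ?R' = "alg2_run x' z tie"
  have "?R t = ?R' t \<and> num_pulls p i t = num_pulls q i t \<or> j \<le> num_pulls p i t \<and> j \<le> num_pulls q i t"
  proof (induction t)
    case (Suc t)
    show ?case
    proof (cases "j \<le> num_pulls p i t \<or> j \<le> num_pulls q i t")
      case True
      then have "j \<le> num_pulls p i t \<and> j \<le> num_pulls q i t" using Suc by auto
      then show ?thesis by (auto simp: num_pulls_Suc)
    next
      case False
      then have run: "?R t = ?R' t" and N: "num_pulls p i t = num_pulls q i t" using Suc by auto
      have step: "alg2_step x z b u (fst (?R t)) = alg2_step x' z b u (fst (?R t))" for b u
      proof (cases "t = 0")
        case True
        then show ?thesis by (simp add: alg2_step_def Let_def)
      next
        case t: False
        show ?thesis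
        proof (rule alg2_step_agree)
          fix i' j' assume "j' \<le> num_pulls (alg2_arm x z tie) i' t"
          then have "(i', j') \<noteq> (i, j)" using False by (auto simp: p_def)
          then show "x i' j' = x' i' j'" by (rule x')
        qed (use t in auto)
      qed
      then have st: "fst (?R (Suc t)) = fst (?R' (Suc t))" unfolding st_Suc by (simp add: run)
      then have pq: "p (Suc t) = q (Suc t)" by (simp add: p_def q_def alg2_arm_def)
      then have N': "num_pulls p i (Suc t) = num_pulls q i (Suc t)" using N by (simp add: num_pulls_Suc)
      show ?thesis
      proof (cases "j \<le> num_pulls p i (Suc t)")
        case True
        then show ?thesis using N' by simp
      next
        case False
        have ne: "(p (Suc t), num_pulls p (p (Suc t)) (Suc t)) \<noteq> (i, j)" using False by auto
        have "observe x z (fst (?R (Suc t))) = observe x' z (fst (?R (Suc t)))"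
          using x'[OF ne] arm_pulls(1)[of "Suc t" x z tie]
          unfolding observe_def p_def arm_eq by simp
        then have "?R (Suc t) = ?R' (Suc t)"
          using st run by (intro prod_eqI) (simp_all only: snd_run_Suc)
        then show ?thesis using N' by blast
      qed
    qed
  qed simp
  then show ?thesis by auto
qed

section \<open>Pulls within one epoch\<close>

text \<open>The radius is \<open>7/8\<close> of the exploration bonus of UCB: the probabilities are still summable over
  \<open>T\<close>, and the bonus exceeds the deviation by a constant factor.\<close>

definition deviates :: "(nat \<Rightarrow> real) \<Rightarrow> real \<Rightarrow> nat \<Rightarrow> bool" where
  "deviates r m T \<longleftrightarrow>
     (\<exists>k\<in>{1..T}. 7 / 8 * sqrt (2 * ln (real T) / real k) \<le> \<bar>(\<Sum>j=1..k. r j) / real k - m\<bar>)"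

text \<open>This count and the next range over all values up to \<open>n\<close>, reached by the run
  or not. They are thus functions of the rewards and the sample of one pair of arms, independent of
  the past. The value \<open>T = 1\<close> is left out because \<open>ln 1 = 0\<close> makes the
  radius vanish.\<close>

definition deviation_count :: "(nat \<Rightarrow> real) \<Rightarrow> real \<Rightarrow> nat \<Rightarrow> nat" where
  "deviation_count r m n = card {T \<in> {2..n}. deviates r m T}"

definition survival_count :: "(nat \<Rightarrow> nat \<Rightarrow> real) \<Rightarrow> real \<Rightarrow> nat \<Rightarrow> nat \<Rightarrow> nat" where
  "survival_count x \<zeta> s n = card {m \<in> {1..n}. \<not> discard_test x \<zeta> s m}"

lemma ucb_index_bounds:
  assumes "\<not> deviates r m T" "1 \<le> k" "k \<le> T"
  shows "m + sqrt (2 * ln (real T) / real k) / 8 < ucb_index r k T"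
    and "ucb_index r k T < m + 15 / 8 * sqrt (2 * ln (real T) / real k)"
proof -
  have "\<bar>(\<Sum>j=1..k. r j) / real k - m\<bar> < 7 / 8 * sqrt (2 * ln (real T) / real k)"
    using assms by (force simp: deviates_def not_le)
  then show "m + sqrt (2 * ln (real T) / real k) / 8 < ucb_index r k T"
    and "ucb_index r k T < m + 15 / 8 * sqrt (2 * ln (real T) / real k)"
    unfolding ucb_index_def by linarith+
qed

context
  fixes x :: "nat \<Rightarrow> nat \<Rightarrow> real" and z :: "nat \<Rightarrow> real" and tie :: "nat \<Rightarrow> history \<Rightarrow> bool"
    and s a b n :: nat and ma mb :: real
  assumes s: "1 \<le> s" and ab: "{a, b} = {s, Suc s}"
begin

abbreviation (input) "ep' \<equiv> ep x z tie"
abbreviation (input) "arm' \<equiv> arm x z tie"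

text \<open>A play of \<open>b\<close> is its forced first pull, or comes at a local time at which
  some average deviates, or is controlled through \<open>L\<close>. Each deviating local time is
  charged with one play, for each of the two arms.\<close>

lemma card_epoch_plays:
  assumes "0 \<le> L"
    and L: "\<And>t. \<lbrakk>s < t; t < n; ep' t = s; ep' (Suc t) = s; arm' (Suc t) = b;
      \<not> deviates (x a) ma (Suc t - s); \<not> deviates (x b) mb (Suc t - s)\<rbrakk> \<Longrightarrow> real (num_pulls arm' b t) \<le> L"
  shows "real (card {t \<in> {1..n}. ep' t = s \<and> arm' t = b})
    \<le> 1 + L + real (deviation_count (x a) ma n) + real (deviation_count (x b) mb n)"
proof -
  define W where "W = {t. s < t \<and> t < n \<and> ep' t = s \<and> ep' (Suc t) = s \<and> arm' (Suc t) = b}"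
  define V where "V = {t \<in> W. \<not> deviates (x a) ma (Suc t - s) \<and> \<not> deviates (x b) mb (Suc t - s)}"
  \<comment> \<open>\<open>T = Suc t - s\<close> is the number of plays of the epoch before the play
    at \<open>Suc t\<close>; this map recovers \<open>t\<close> from it.\<close>
  define Dev where "Dev r m = (\<lambda>T. T + s - 1) ` {T \<in> {2..n}. deviates r m T}" for r m
  have W: "finite W" unfolding W_def by auto
  have V: "finite V" using W by (simp add: V_def)
  \<comment> \<open>Arms are named by their query times, so the first pull of \<open>b\<close> takes
    place at time \<open>b\<close>.\<close>
  have "{t \<in> {1..n}. ep' t = s \<and> arm' t = b} \<subseteq> insert b (Suc ` W)"
  proof
    fix t assume "t \<in> {t \<in> {1..n}. ep' t = s \<and> arm' t = b}"
    then have t: "1 \<le> t" "t \<le> n" "ep' t = s" "arm' t = b" by auto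
    note f = ep_bounds[OF t(1), of x z tie] pulls_sum[OF t(1), of x z tie]
      pulls_pos(1)[OF t(1), of x z tie] arm_cases[OF t(1), of x z tie]
    have "s \<le> t" using f t by simp
    consider "t = s" | "t = Suc s" | t' where "t = Suc t'" "s < t'"
      using \<open>s \<le> t\<close> by (cases t) (auto simp: le_Suc_eq less_Suc_eq_le order_le_less)
    then show "t \<in> insert b (Suc ` W)"
    proof cases
      case 1
      then have "b = s" using f t by auto
      then show ?thesis using 1 by simp
    next
      case 2
      have es: "ep' s = s" using ep_const[OF t(3) s order_refl] 2 by simp
      have s1: "num_pulls arm' s s = 1" "num_pulls arm' (Suc s) s = 0"
        using pulls_sum[OF s, of x z tie] pulls_pos(1)[OF s, of x z tie] es by simp_all
      have "num_pulls arm' (Suc s) t \<noteq> 0"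
        using pulls_pos(2)[OF t(1), of x z tie] t 2 by auto
      then have "arm' t = Suc s" using s1 by (simp add: 2 num_pulls_Suc split: if_splits)
      then show ?thesis using t 2 by simp
    next
      case 3
      have "ep' t' = s" using ep_const[OF t(3) s, of t'] 3 by simp
      then show ?thesis using t 3 by (auto simp: W_def)
    qed
  qed
  moreover have "W \<subseteq> V \<union> Dev (x a) ma \<union> Dev (x b) mb"
  proof
    fix t assume t: "t \<in> W"
    then have "t = (Suc t - s) + s - 1" "Suc t - s \<in> {2..n}" using s by (auto simp: W_def)
    then show "t \<in> V \<union> Dev (x a) ma \<union> Dev (x b) mb"
      using t unfolding V_def Dev_def by blast
  qed
  ultimately have "{t \<in> {1..n}. ep' t = s \<and> arm' t = b}
      \<subseteq> insert b (Suc ` (V \<union> Dev (x a) ma \<union> Dev (x b) mb))"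
    by blast
  then have "card {t \<in> {1..n}. ep' t = s \<and> arm' t = b}
      \<le> card (insert b (Suc ` (V \<union> Dev (x a) ma \<union> Dev (x b) mb)))"
    by (rule card_mono[rotated]) (simp add: V Dev_def)
  also have "\<dots> \<le> Suc (card (Suc ` (V \<union> Dev (x a) ma \<union> Dev (x b) mb)))"
    by (rule card_insert_le_m1) auto
  also have "\<dots> \<le> Suc (card (V \<union> Dev (x a) ma \<union> Dev (x b) mb))"
    by (simp add: card_image)
  also have "\<dots> \<le> Suc (card V + card (Dev (x a) ma) + card (Dev (x b) mb))"
    using card_Un_le[of "V \<union> Dev (x a) ma" "Dev (x b) mb"] card_Un_le[of V "Dev (x a) ma"] by simp
  also have "\<dots> \<le> Suc (card V + deviation_count (x a) ma n + deviation_count (x b) mb n)"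
    unfolding Dev_def deviation_count_def by (simp add: add_mono card_image_le)
  finally have "real (card {t \<in> {1..n}. ep' t = s \<and> arm' t = b})
    \<le> 1 + real (card V) + real (deviation_count (x a) ma n) + real (deviation_count (x b) mb n)"
    by simp
  moreover have "real (card V) \<le> L"
  proof (rule card_pulls_le[OF V _ \<open>0 \<le> L\<close>])
    fix t assume "t \<in> V"
    then show "arm' (Suc t) = b \<and> 1 \<le> num_pulls arm' b t \<and> real (num_pulls arm' b t) \<le> L"
      using L[of t] epoch_play(3)[OF _ _ _ s _ ab, of x z tie t] by (auto simp: V_def W_def)
  qed
  ultimately show ?thesis by simp
qed

text \<open>If neither average deviates, a play of \<open>b\<close> forces the gap below
  \<open>15 / 8\<close> of the bonus of \<open>b\<close>; the eighth left on the side of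
  \<open>a\<close> is dropped. Rounding up to 2 and squaring gives \<open>4 * 2 = 8\<close>, the
  constant of the final bound.\<close>

lemma card_inferior_plays:
  assumes gap: "mb < ma" and n: "1 \<le> n"
  shows "real (card {t \<in> {1..n}. ep' t = s \<and> arm' t = b})
    \<le> 1 + 8 * ln (real n) / (ma - mb)\<^sup>2
      + real (deviation_count (x a) ma n) + real (deviation_count (x b) mb n)"
proof (rule card_epoch_plays)
  show "0 \<le> 8 * ln (real n) / (ma - mb)\<^sup>2" using n by simp
  fix t assume t: "s < t" "t < n" "ep' t = s" "ep' (Suc t) = s" "arm' (Suc t) = b"
    and dev: "\<not> deviates (x a) ma (Suc t - s)" "\<not> deviates (x b) mb (Suc t - s)"
  define T l k where "T = Suc t - s" and "l = num_pulls arm' b t" and "k = num_pulls arm' a t"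
  note p = epoch_play[OF t(3,1,4) s t(5) ab, folded T_def l_def k_def]
  have T: "2 \<le> T" "T \<le> n" using t s by (auto simp: T_def)
  have "ma + sqrt (2 * ln (real T) / real k) / 8 < mb + 15 / 8 * sqrt (2 * ln (real T) / real l)"
    using ucb_index_bounds(1)[OF dev(1), folded T_def, of k] ucb_index_bounds(2)[OF dev(2), folded T_def, of l] p
    by simp
  moreover have "0 \<le> sqrt (2 * ln (real T) / real k)" using T by simp
  moreover have pos: "0 \<le> sqrt (2 * ln (real T) / real l)" using T by simp
  ultimately have "ma - mb \<le> 2 * sqrt (2 * ln (real T) / real l)" by linarith
  then have "(ma - mb)\<^sup>2 \<le> (2 * sqrt (2 * ln (real T) / real l))\<^sup>2"
    using gap by (intro power_mono) auto
  also have "\<dots> = 8 * ln (real T) / real l"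
    using T by (simp add: power_mult_distrib)
  finally have "real l * (ma - mb)\<^sup>2 \<le> 8 * ln (real T)"
    using p(3) by (simp add: field_simps)
  also have "\<dots> \<le> 8 * ln (real n)" using T by simp
  finally show "real l \<le> 8 * ln (real n) / (ma - mb)\<^sup>2"
    using gap by (simp add: field_simps)
qed

text \<open>With equal means, the comparison of indices leaves an eighth of the bonus of
  \<open>a\<close> against \<open>15 / 8\<close> of that of \<open>b\<close>. So the bonus of
  \<open>a\<close> is at most 15 times that of \<open>b\<close>, and the count of \<open>b\<close>
  at most \<open>225 = 15 * 15\<close> times that of \<open>a\<close>. A deviation radius equal to
  the full bonus would leave nothing on the side of \<open>a\<close>. The smaller count is bounded
  by survivals because every test up to it was passed.\<close>

lemma card_equal_plays:
  assumes "ma = mb"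
  shows "real (card {t \<in> {1..n}. ep' t = s \<and> arm' t = b})
    \<le> 1 + 225 * real (survival_count x (z s) s n)
      + real (deviation_count (x a) ma n) + real (deviation_count (x b) mb n)"
proof (rule card_epoch_plays)
  fix t assume t: "s < t" "t < n" "ep' t = s" "ep' (Suc t) = s" "arm' (Suc t) = b"
    and dev: "\<not> deviates (x a) ma (Suc t - s)" "\<not> deviates (x b) mb (Suc t - s)"
  define T l k where "T = Suc t - s" and "l = num_pulls arm' b t" and "k = num_pulls arm' a t"
  note p = epoch_play[OF t(3,1,4) s t(5) ab, folded T_def l_def k_def]
  have T: "2 \<le> T" "T \<le> n" using t s by (auto simp: T_def)
  then have lnT: "0 < ln (real T)" by simp
  have "ma + sqrt (2 * ln (real T) / real k) / 8 < mb + 15 / 8 * sqrt (2 * ln (real T) / real l)"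
    using ucb_index_bounds(1)[OF dev(1), folded T_def, of k] ucb_index_bounds(2)[OF dev(2), folded T_def, of l] p
    by simp
  then have "sqrt (2 * ln (real T) / real k) \<le> 15 * sqrt (2 * ln (real T) / real l)"
    using assms by simp
  then have "(sqrt (2 * ln (real T) / real k))\<^sup>2 \<le> (15 * sqrt (2 * ln (real T) / real l))\<^sup>2"
    using lnT by (intro power_mono) auto
  then have "2 * ln (real T) / real k \<le> 225 * (2 * ln (real T) / real l)"
    using lnT by (simp add: power_mult_distrib)
  then have "real l \<le> 225 * real k"
    using lnT p(2,3) by (simp add: field_simps)
  then have "real l \<le> 225 * real (min k l)" by (simp add: min_def)
  moreover have "min k l \<le> survival_count x (z s) s n"
  proof -
    have "{1..min k l} \<subseteq> {m \<in> {1..n}. \<not> discard_test x (z s) s m}"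
      using p(4,5) T by auto
    from card_mono[OF _ this] show ?thesis by (simp add: survival_count_def)
  qed
  ultimately show "real l \<le> 225 * real (survival_count x (z s) s n)" by linarith
qed simp

end

lemma card_epoch_length:
  assumes s: "1 \<le> s"
  shows "real (card {t \<in> {1..n}. ep x z tie t = s})
    \<le> 2 + 450 * real (survival_count x (z s) s n)
      + 2 * real (deviation_count (x s) m n) + 2 * real (deviation_count (x (Suc s)) m n)"
proof -
  have "{t \<in> {1..n}. ep x z tie t = s}
     \<subseteq> {t \<in> {1..n}. ep x z tie t = s \<and> arm x z tie t = s} \<union> {t \<in> {1..n}. ep x z tie t = s \<and> arm x z tie t = Suc s}"
    (is "?A \<subseteq> ?B \<union> ?C") using arm_cases[of _ x z tie] by auto
  then have "card ?A \<le> card (?B \<union> ?C)" by (intro card_mono) auto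
  also have "\<dots> \<le> card ?B + card ?C" by (rule card_Un_le)
  finally have "real (card ?A) \<le> real (card ?B) + real (card ?C)" by simp
  then show ?thesis
    using card_equal_plays[OF s, where a = "Suc s" and b = s and ma = m and mb = m and x = x and z = z and tie = tie and n = n]
      card_equal_plays[OF s, where a = s and b = "Suc s" and ma = m and mb = m and x = x and z = z and tie = tie and n = n]
    by (simp add: insert_commute)
qed

lemma not_discarded_if_drift:
  assumes range: "\<And>i j. i \<in> {s, Suc s} \<Longrightarrow> 1 \<le> j \<Longrightarrow> x i j \<in> {0..1}"
    and \<sigma>: "\<sigma> = 1 \<or> \<sigma> = -1" and z: "bound_f (real T) \<le> \<sigma> * \<zeta>" and T: "1 \<le> T"
    and drift: "\<And>m. T \<le> m \<Longrightarrow> 4 * sqrt (real m * ln (real m)) \<le> \<sigma> * (\<Sum>j=1..m. x s j - x (Suc s) j)"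
    and m: "1 \<le> m"
  shows "\<not> discard_test x \<zeta> s m"
proof -
  have "4 * sqrt (real m * ln (real m)) \<le> \<sigma> * \<zeta> + \<sigma> * (\<Sum>j=1..m. x s j - x (Suc s) j)"
  proof (cases "T \<le> m")
    case True
    \<comment> \<open>The sample has the sign of the drift, so from \<open>T\<close> on it can only
      help.\<close>
    have "0 \<le> bound_f (real T)" using T by (simp add: bound_f_def)
    then show ?thesis using drift[OF True] z by linarith
  next
    case False
    \<comment> \<open>Below \<open>T\<close>, \<open>bound_f\<close> covers the two worst cases
      together: a partial sum of \<open>- T\<close> and the threshold at \<open>T\<close>.\<close>
    have "sqrt (real m * ln (real m)) \<le> sqrt (real T * ln (real T))"
      using m False by (intro real_sqrt_le_mono mult_mono) auto
    moreover have "\<bar>\<Sum>j=1..m. x s j - x (Suc s) j\<bar> \<le> (\<Sum>j=1..m. 1)"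
    proof (rule order_trans[OF sum_abs sum_mono])
      fix j assume "j \<in> {1..m}"
      then show "\<bar>x s j - x (Suc s) j\<bar> \<le> 1" using range[of s j] range[of "Suc s" j] by auto
    qed
    moreover have "real m \<le> real T" using False by simp
    ultimately have "- real T \<le> \<sigma> * (\<Sum>j=1..m. x s j - x (Suc s) j)"
      using \<sigma> by auto
    then show ?thesis
      using z \<open>sqrt (real m * ln (real m)) \<le> sqrt (real T * ln (real T))\<close> unfolding bound_f_def by linarith
  qed
  also have "\<dots> \<le> \<bar>\<zeta> + (\<Sum>j=1..m. x s j - x (Suc s) j)\<bar>" using \<sigma> by auto
  finally show ?thesis by (simp add: discard_test_def)
qed

section \<open>Measurability and independence\<close>

text \<open>States being countable, the measurability of a step may be checked for each fixed state.
  Histories contain reals and are handled in a product sigma-algebra instead.\<close>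

instance alg_state_ext :: (countable) countable
proof (rule countable_classI)
  fix \<sigma> \<tau> :: "'a alg_state_scheme"
  let ?enc = "\<lambda>\<sigma> :: 'a alg_state_scheme. to_nat (epoch_start \<sigma>, pulls1 \<sigma>, pulls2 \<sigma>, mcount \<sigma>, last_arm \<sigma>, alg_state.more \<sigma>)"
  assume "?enc \<sigma> = ?enc \<tau>"
  then show "\<sigma> = \<tau>" by simp
qed

lemma measurable_alg2_run:
  assumes x [measurable]: "\<And>i j. (\<lambda>\<omega>. x \<omega> i j) \<in> borel_measurable N"
    and z [measurable]: "\<And>i. (\<lambda>\<omega>. z \<omega> i) \<in> borel_measurable N"
    and u [measurable]: "u \<in> borel_measurable N"
    and tie: "\<And>t. (\<lambda>(h, u). tie t h u) \<in> measurable
          ((\<Pi>\<^sub>M s\<in>UNIV. count_space UNIV \<Otimes>\<^sub>M borel \<Otimes>\<^sub>M borel) \<Otimes>\<^sub>M borel) (count_space UNIV)"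
  shows "(\<lambda>\<omega>. fst (alg2_run (x \<omega>) (z \<omega>) (\<lambda>t h. tie t h (u \<omega>)) t)) \<in> N \<rightarrow>\<^sub>M count_space UNIV \<and>
    (\<lambda>\<omega>. snd (alg2_run (x \<omega>) (z \<omega>) (\<lambda>t h. tie t h (u \<omega>)) t))
      \<in> N \<rightarrow>\<^sub>M (\<Pi>\<^sub>M s\<in>UNIV. count_space UNIV \<Otimes>\<^sub>M borel \<Otimes>\<^sub>M borel)"
proof (induction t)
  case 0
  show ?case by (simp add: space_PiM space_pair_measure)
next
  case (Suc t)
  define \<sigma> where "\<sigma> = (\<lambda>\<omega>. fst (alg2_run (x \<omega>) (z \<omega>) (\<lambda>t h. tie t h (u \<omega>)) t))"
  define h where "h = (\<lambda>\<omega>. snd (alg2_run (x \<omega>) (z \<omega>) (\<lambda>t h. tie t h (u \<omega>)) t))"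
  define \<sigma>' where "\<sigma>' = (\<lambda>\<omega>. fst (alg2_run (x \<omega>) (z \<omega>) (\<lambda>t h. tie t h (u \<omega>)) (Suc t)))"
  have \<sigma> [measurable]: "\<sigma> \<in> N \<rightarrow>\<^sub>M count_space UNIV"
    and h [measurable]: "h \<in> N \<rightarrow>\<^sub>M (\<Pi>\<^sub>M s\<in>UNIV. count_space UNIV \<Otimes>\<^sub>M borel \<Otimes>\<^sub>M borel)"
    using Suc by (simp_all add: \<sigma>_def h_def)
  define b where "b = (\<lambda>\<omega>. tie (Suc t) (h \<omega>) (u \<omega>))"
  have b [measurable]: "b \<in> N \<rightarrow>\<^sub>M count_space UNIV"
    using measurable_compose[OF measurable_Pair[OF h u] tie[of "Suc t"]] by (simp add: b_def)
  have "(\<lambda>\<omega>. alg2_step (x \<omega>) (z \<omega>) (b \<omega>) (Suc t) \<tau>) \<in> N \<rightarrow>\<^sub>M count_space UNIV" for \<tau>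
    unfolding alg2_step_def Let_def ucb_index_def discard_test_def by measurable
  from measurable_compose_countable[OF this \<sigma>]
  have \<sigma>' [measurable]: "\<sigma>' \<in> N \<rightarrow>\<^sub>M count_space UNIV"
    unfolding \<sigma>'_def st_Suc b_def \<sigma>_def h_def by simp
  have "(\<lambda>\<omega>. observe (x \<omega>) (z \<omega>) \<tau>) \<in> N \<rightarrow>\<^sub>M count_space UNIV \<Otimes>\<^sub>M borel \<Otimes>\<^sub>M borel" for \<tau>
    unfolding observe_def by measurable
  from measurable_compose_countable[OF this \<sigma>']
  have obs: "(\<lambda>\<omega>. observe (x \<omega>) (z \<omega>) (\<sigma>' \<omega>)) \<in> N \<rightarrow>\<^sub>M count_space UNIV \<Otimes>\<^sub>M borel \<Otimes>\<^sub>M borel" .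
  have "(\<lambda>\<omega>. (h \<omega>)(Suc t := observe (x \<omega>) (z \<omega>) (\<sigma>' \<omega>)))
      \<in> N \<rightarrow>\<^sub>M (\<Pi>\<^sub>M s\<in>UNIV. count_space UNIV \<Otimes>\<^sub>M borel \<Otimes>\<^sub>M borel)"
    by (rule measurable_fun_upd[where J = UNIV]) (use h obs in auto)
  then show ?case
    using \<sigma>' unfolding \<sigma>'_def snd_run_Suc h_def by blast
qed

context alg2_bandit
begin

section \<open>Sigma-algebras generated by sets of sources\<close>

abbreviation X :: "source \<Rightarrow> 'a \<Rightarrow> real" where "X \<equiv> source_var \<kappa> Y Z U"

definition generated :: "source set \<Rightarrow> 'a measure" where
  "generated J = sigma (space M) (\<Union>r\<in>J. {X r -` A \<inter> space M | A. A \<in> sets borel})"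

lemma space_generated [simp]: "space (generated J) = space M"
  unfolding generated_def by (rule space_measure_of) auto

lemma sets_generated:
  "sets (generated J) = sigma_sets (space M) (\<Union>r\<in>J. {X r -` A \<inter> space M | A. A \<in> sets borel})"
  unfolding generated_def by (rule sets_measure_of) auto

lemma X_measurable_generated: "r \<in> J \<Longrightarrow> X r \<in> borel_measurable (generated J)"
  by (rule measurableI) (auto simp: sets_generated intro!: sigma_sets.Basic)

lemma X_measurable: "r \<in> sources \<Longrightarrow> X r \<in> borel_measurable M"
  using independent by (auto simp: indep_vars_def2)

lemma subalgebra_generated: "J \<subseteq> sources \<Longrightarrow> subalgebra M (generated J)"
  unfolding subalgebra_def sets_generated space_generated
  by (intro conjI refl sets.sigma_sets_subset) (auto intro!: measurable_sets[OF X_measurable])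

lemma generated_events: "J \<subseteq> sources \<Longrightarrow> A \<in> sets (generated J) \<Longrightarrow> A \<in> events"
  using subalgebra_generated by (auto simp: subalgebra_def)

lemma generated_measurable:
  "J \<subseteq> sources \<Longrightarrow> f \<in> borel_measurable (generated J) \<Longrightarrow> f \<in> borel_measurable M"
  using measurable_from_subalg[OF subalgebra_generated] .

text \<open>Preimages under a single source are closed under intersection, so independence of the
  sources survives the grouping into the blocks \<open>J\<close> and \<open>K\<close> and the
  passage to the generated sigma-algebras.\<close>

lemma prob_Int_generated:
  assumes "J \<subseteq> sources" "K \<subseteq> sources" "J \<inter> K = {}"
    and A: "A \<in> sets (generated J)" and B: "B \<in> sets (generated K)"
  shows "prob (A \<inter> B) = prob A * prob B"
proof -
  let ?F = "case_bool J K"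
  have "indep_sets (\<lambda>r. {X r -` A \<inter> space M | A. A \<in> sets borel}) (\<Union>b\<in>UNIV. ?F b)"
    by (rule indep_sets_mono_index[of _ sources]) (use assms independent in \<open>auto simp: indep_vars_def2 UNIV_bool\<close>)
  then have "indep_sets (\<lambda>b. sigma_sets (space M) (\<Union>r\<in>?F b. {X r -` A \<inter> space M | A. A \<in> sets borel})) UNIV"
  proof (rule indep_sets_collect_sigma)
    show "disjoint_family_on ?F UNIV" using assms by (auto simp: disjoint_family_on_def split: bool.split)
    fix r show "Int_stable {X r -` A \<inter> space M | A. A \<in> sets borel}"
    proof (rule Int_stableI, safe)
      fix A B :: "real set" assume "A \<in> sets borel" "B \<in> sets borel"
      then show "\<exists>C. X r -` A \<inter> space M \<inter> (X r -` B \<inter> space M) = X r -` C \<inter> space M \<and> C \<in> sets borel"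
        by (intro exI[of _ "A \<inter> B"]) auto
    qed
  qed
  then have "indep_sets (case_bool (sets (generated J)) (sets (generated K))) UNIV"
    by (rule indep_sets_mono_sets) (auto simp: sets_generated split: bool.split)
  then show ?thesis using A B by (auto simp: indep_set_def[symmetric] indep_sets2_eq)
qed

lemma expectation_indicator_generated:
  fixes g :: "'a \<Rightarrow> real"
  assumes "J \<subseteq> sources" "K \<subseteq> sources" "J \<inter> K = {}"
    and A: "A \<in> sets (generated J)" and g: "g \<in> borel_measurable (generated K)" "integrable M g"
  shows "expectation (\<lambda>\<omega>. indicator A \<omega> * g \<omega>) = prob A * expectation g"
proof -
  have ind: "(indicator A :: 'a \<Rightarrow> real) \<in> borel_measurable (generated J)" using A by simp
  have "indep_var borel (indicator A :: 'a \<Rightarrow> real) borel g"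
    unfolding indep_var_eq
  proof (intro conjI)
    show "random_variable borel (indicator A :: 'a \<Rightarrow> real)" "random_variable borel g"
      using generated_measurable assms ind by blast+
    have sub: "sigma_sets (space M) {f -` S \<inter> space M | S. S \<in> sets borel} \<subseteq> sets (generated L)"
      if "f \<in> borel_measurable (generated L)" for f :: "'a \<Rightarrow> real" and L
    proof -
      have "{f -` S \<inter> space M | S. S \<in> sets borel} \<subseteq> sets (generated L)"
        using measurable_sets[OF that] by auto
      from sets.sigma_sets_subset[OF this] show ?thesis by simp
    qed
    have sub': "sets (generated L) \<subseteq> events" if "L \<subseteq> sources" for L
      using generated_events[OF that] by auto
    show "indep_set (sigma_sets (space M) {indicator A -` S \<inter> space M | S. S \<in> sets (borel :: real measure)})
       (sigma_sets (space M) {g -` S \<inter> space M | S. S \<in> sets borel})"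
      unfolding indep_sets2_eq
      using sub[OF ind] sub[OF g(1)] sub'[OF assms(1)] sub'[OF assms(2)] prob_Int_generated[OF assms(1-3)]
      by (intro conjI ballI) blast+
  qed
  moreover have "integrable M (indicator A :: 'a \<Rightarrow> real)"
    using generated_events[OF assms(1) A] by (simp add: emeasure_eq_measure)
  ultimately have "expectation (\<lambda>\<omega>. indicator A \<omega> * g \<omega>) = expectation (indicator A) * expectation g"
    using g(2) by (intro indep_var_lebesgue_integral) auto
  then show ?thesis using generated_events[OF assms(1) A] by simp
qed

lemma type_generated: "Type_of i \<in> J \<Longrightarrow> {\<omega> \<in> space M. \<kappa> i \<omega> = k} \<in> sets (generated J)"
  using measurable_sets[OF X_measurable_generated[of "Type_of i" J], of "{real k}"]
  by (auto simp: vimage_def Int_def conj_commute)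

lemma reward_generated:
  "Reward_of k i j \<in> J \<Longrightarrow> Y k i j \<in> borel_measurable (generated J)"
  using X_measurable_generated[of "Reward_of k i j" J] by simp

text \<open>Replacing all values outside \<open>J\<close> by 0 gives a run that is measurable with
  respect to \<open>J\<close> by construction; it agrees with the true run as long as no missing
  value is read. Both potential rewards are demanded because the type selects between them.\<close>

definition known_rewards :: "source set \<Rightarrow> 'a \<Rightarrow> nat \<Rightarrow> nat \<Rightarrow> real" where
  "known_rewards J \<omega> i j =
     (if 1 \<le> i \<and> {Type_of i, Reward_of 1 i j, Reward_of 2 i j} \<subseteq> J then rewards \<kappa> Y \<omega> i j else 0)"

definition known_samples :: "source set \<Rightarrow> 'a \<Rightarrow> nat \<Rightarrow> real" where
  "known_samples J \<omega> i = (if Gauss i \<in> J then Z i \<omega> else 0)"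

definition run :: "'a \<Rightarrow> nat \<Rightarrow> alg_state \<times> history" where
  "run \<omega> = alg2_run (rewards \<kappa> Y \<omega>) (\<lambda>i. Z i \<omega>) (\<lambda>t h. tie t h (U \<omega>))"

definition known_run :: "source set \<Rightarrow> 'a \<Rightarrow> nat \<Rightarrow> alg_state \<times> history" where
  "known_run J \<omega> = alg2_run (known_rewards J \<omega>) (known_samples J \<omega>) (\<lambda>t h. tie t h (U \<omega>))"

lemma known_rewards_measurable: "(\<lambda>\<omega>. known_rewards J \<omega> i j) \<in> borel_measurable (generated J)"
proof (cases "1 \<le> i \<and> {Type_of i, Reward_of 1 i j, Reward_of 2 i j} \<subseteq> J")
  case True
  have "Measurable.pred (generated J) (\<lambda>\<omega>. \<kappa> i \<omega> = 1)"
    using type_generated[of i J 1] True by (simp add: pred_def)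
  moreover have "Y 1 i j \<in> borel_measurable (generated J)" "Y 2 i j \<in> borel_measurable (generated J)"
    using True by (auto intro: reward_generated)
  ultimately have "(\<lambda>\<omega>. if \<kappa> i \<omega> = 1 then Y 1 i j \<omega> else Y 2 i j \<omega>) \<in> borel_measurable (generated J)"
    by measurable
  also have "?this \<longleftrightarrow> (\<lambda>\<omega>. known_rewards J \<omega> i j) \<in> borel_measurable (generated J)"
  proof (rule measurable_cong)
    fix \<omega> assume "\<omega> \<in> space (generated J)"
    then show "(if \<kappa> i \<omega> = 1 then Y 1 i j \<omega> else Y 2 i j \<omega>) = known_rewards J \<omega> i j"
      using True arm_types[of i \<omega>] by (auto simp: known_rewards_def rewards_def)
  qed
  finally show ?thesis .
qed (auto simp: known_rewards_def)

lemma known_samples_measurable: "(\<lambda>\<omega>. known_samples J \<omega> i) \<in> borel_measurable (generated J)"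
  using X_measurable_generated[of "Gauss i" J] by (cases "Gauss i \<in> J") (simp_all add: known_samples_def)

lemma known_run_measurable:
  assumes "Seed \<in> J"
  shows "(\<lambda>\<omega>. fst (known_run J \<omega> t)) \<in> generated J \<rightarrow>\<^sub>M count_space UNIV"
  unfolding known_run_def
  using measurable_alg2_run[OF known_rewards_measurable known_samples_measurable _ tie_measurable, of U J]
    X_measurable_generated[OF assms] by simp

text \<open>Rewards with an index 0 are not sources and carry no measurability. The run never reads
  them, so they may be set to 0.\<close>

lemma run_eq_known_run: "run \<omega> t = known_run sources \<omega> t"
  unfolding run_def known_run_def
  by (rule conjunct1[OF alg2_run_cong]) (auto simp: known_rewards_def known_samples_def sources_def)

definition play :: "'a \<Rightarrow> nat \<Rightarrow> nat" where
  "play \<omega> = alg2_arm (rewards \<kappa> Y \<omega>) (\<lambda>i. Z i \<omega>) (\<lambda>t h. tie t h (U \<omega>))"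

definition epoch :: "'a \<Rightarrow> nat \<Rightarrow> nat" where
  "epoch \<omega> t = epoch_start (fst (run \<omega> t))"

lemma play_bounds: "1 \<le> t \<Longrightarrow> 1 \<le> play \<omega> t \<and> play \<omega> t \<le> t"
  unfolding play_def by (rule arm_bounds)

lemma play_eq: "play \<omega> t = last_arm (fst (run \<omega> t))"
  by (simp add: play_def run_def alg2_arm_def)

text \<open>The seed counts as past: one randomization serves all epochs, and the pathwise bounds on
  an epoch hold for every tie-breaking. The types of the arms \<open>s\<close> and
  \<open>Suc s\<close> form a block of their own.\<close>

definition past :: "nat \<Rightarrow> source set" where
  "past s = {Type_of i | i. i \<in> {1..<s}} \<union> {Reward_of k i j | k i j. k \<in> {1, 2} \<and> i \<in> {1..<s} \<and> j \<ge> 1}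
     \<union> {Gauss i | i. i \<in> {1..<s}} \<union> {Seed}"

lemma past_subset: "past s \<subseteq> sources"
  by (auto simp: past_def sources_def)

definition starts :: "nat \<Rightarrow> 'a set" where
  "starts s = {\<omega> \<in> space M. epoch \<omega> s = s}"

lemma starts_generated:
  assumes "1 \<le> s"
  shows "starts s \<in> sets (generated (past s))"
proof -
  obtain t where s: "s = Suc t" using assms by (cases s) auto
  have "fst (run \<omega> s) = fst (known_run (past s) \<omega> s)" for \<omega>
    unfolding run_def known_run_def s
    by (rule conjunct2[OF alg2_run_cong]) (auto simp: known_rewards_def known_samples_def past_def)
  then have eq: "starts s = (\<lambda>\<omega>. fst (known_run (past s) \<omega> s)) -` {\<sigma>. epoch_start \<sigma> = s} \<inter> space (generated (past s))"
    by (auto simp: starts_def epoch_def)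
  show ?thesis
    unfolding eq by (rule measurable_sets[OF known_run_measurable]) (auto simp: past_def)
qed

definition pulled :: "nat \<Rightarrow> nat \<Rightarrow> nat \<Rightarrow> 'a set" where
  "pulled n i j = {\<omega> \<in> space M. j \<le> num_pulls (play \<omega>) i n}"

text \<open>Whether arm \<open>i\<close> is pulled \<open>j\<close> times is decided before the reward of its \<open>j\<close>-th pull is seen.\<close>

lemma pulled_generated:
  fixes i j :: nat
  defines "J \<equiv> sources - {Reward_of 1 i j, Reward_of 2 i j}"
  shows "pulled n i j \<in> sets (generated J)"
proof -
  have S: "Seed \<in> J" by (auto simp: J_def sources_def)
  have eq: "pulled n i j = {\<omega> \<in> space M. j \<le> num_pulls (\<lambda>t. last_arm (fst (known_run J \<omega> t))) i n}"
  proof -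
    have z: "known_samples sources \<omega> = known_samples J \<omega>" for \<omega>
      by (auto simp: known_samples_def J_def)
    have x: "known_rewards sources \<omega> i' j' = known_rewards J \<omega> i' j'" if "(i', j') \<noteq> (i, j)" for \<omega> i' j'
      using that by (auto simp: known_rewards_def J_def)
    have "play \<omega> = alg2_arm (known_rewards sources \<omega>) (known_samples J \<omega>) (\<lambda>t h. tie t h (U \<omega>))" for \<omega>
      by (rule ext) (simp add: play_eq run_eq_known_run known_run_def alg2_arm_def z)
    moreover have "(\<lambda>t. last_arm (fst (known_run J \<omega> t)))
        = alg2_arm (known_rewards J \<omega>) (known_samples J \<omega>) (\<lambda>t h. tie t h (U \<omega>))" for \<omega>
      by (rule ext) (simp add: known_run_def alg2_arm_def)
    ultimately show ?thesis
      unfolding pulled_def using pulls_insensitive[OF x] by simp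
  qed
  have [measurable]: "(\<lambda>\<omega>. last_arm (fst (known_run J \<omega> t))) \<in> generated J \<rightarrow>\<^sub>M count_space UNIV" for t
    by (rule measurable_compose[OF known_run_measurable[OF S]]) simp
  have "(\<lambda>\<omega>. num_pulls (\<lambda>t. last_arm (fst (known_run J \<omega> t))) i n) \<in> generated J \<rightarrow>\<^sub>M count_space UNIV"
  proof (induction n)
    case (Suc n)
    note [measurable] = Suc
    show ?case unfolding num_pulls_Suc of_bool_def by measurable
  qed simp
  from measurable_sets[OF this, of "{j..}"] show ?thesis
    unfolding eq by (simp add: vimage_def Int_def conj_commute)
qed

section \<open>From observed rewards to inferior plays\<close>

lemma reward_integrable:
  assumes "k \<in> {1, 2}" "1 \<le> i" "1 \<le> j"
  shows "integrable M (Y k i j)"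
proof (rule integrable_const_bound[where B = 1])
  show "AE \<omega> in M. norm (Y k i j \<omega>) \<le> 1" using reward_range[OF assms] by force
  show "Y k i j \<in> borel_measurable M"
    using X_measurable[of "Reward_of k i j"] assms by (auto simp: sources_def)
qed

text \<open>The event \<open>B k\<close> reads neither potential reward at \<open>(i, j)\<close>, so
  the expectation factors on each type. For type 1 the factor \<open>\<mu> 1 - \<mu> 1\<close>
  vanishes, and only \<open>B 2\<close> remains.\<close>

lemma expectation_pull:
  fixes n i j :: nat
  assumes ij: "1 \<le> i" "1 \<le> j"
  defines "B \<equiv> \<lambda>k. pulled n i j \<inter> {\<omega> \<in> space M. \<kappa> i \<omega> = k}"
  shows "expectation (\<lambda>\<omega>. indicator (pulled n i j) \<omega> * (\<mu> 1 - rewards \<kappa> Y \<omega> i j)) = (\<mu> 1 - \<mu> 2) * prob (B 2)"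
    and "integrable M (\<lambda>\<omega>. indicator (pulled n i j) \<omega> * (\<mu> 1 - rewards \<kappa> Y \<omega> i j))"
    and "B k \<in> events"
proof -
  define J where "J = sources - {Reward_of 1 i j, Reward_of 2 i j}"
  have J: "J \<subseteq> sources" "Type_of i \<in> J" using ij by (auto simp: J_def sources_def)
  have B: "B k \<in> sets (generated J)" for k
    unfolding B_def using pulled_generated[of n i j] type_generated[OF J(2), of k] by (auto simp: J_def)
  then show Bev: "B k \<in> events" for k using generated_events[OF J(1)] by blast
  have int: "integrable M (\<lambda>\<omega>. indicator (B k) \<omega> * (\<mu> 1 - Y k i j \<omega>))"
    and E: "expectation (\<lambda>\<omega>. indicator (B k) \<omega> * (\<mu> 1 - Y k i j \<omega>)) = prob (B k) * (\<mu> 1 - \<mu> k)"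
    if k: "k \<in> {1, 2}" for k
  proof -
    have iY: "integrable M (\<lambda>\<omega>. \<mu> 1 - Y k i j \<omega>)" using reward_integrable[OF k ij] by simp
    show "integrable M (\<lambda>\<omega>. indicator (B k) \<omega> * (\<mu> 1 - Y k i j \<omega>))"
      using integrable_real_mult_indicator[OF Bev iY] by (simp add: mult.commute)
    have "(\<lambda>\<omega>. \<mu> 1 - Y k i j \<omega>) \<in> borel_measurable (generated {Reward_of k i j})"
      using reward_generated[of k i j "{Reward_of k i j}"] by simp
    then have "expectation (\<lambda>\<omega>. indicator (B k) \<omega> * (\<mu> 1 - Y k i j \<omega>)) = prob (B k) * expectation (\<lambda>\<omega>. \<mu> 1 - Y k i j \<omega>)"
      using k ij J(1) B iY
      by (intro expectation_indicator_generated[where K = "{Reward_of k i j}" and J = J]) (auto simp: J_def sources_def)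
    then show "expectation (\<lambda>\<omega>. indicator (B k) \<omega> * (\<mu> 1 - Y k i j \<omega>)) = prob (B k) * (\<mu> 1 - \<mu> k)"
      using reward_integrable[OF k ij] reward_mean[OF k ij] by (simp add: prob_space)
  qed
  have split: "indicator (pulled n i j) \<omega> * (\<mu> 1 - rewards \<kappa> Y \<omega> i j)
      = indicator (B 1) \<omega> * (\<mu> 1 - Y 1 i j \<omega>) + indicator (B 2) \<omega> * (\<mu> 1 - Y 2 i j \<omega>)" if "\<omega> \<in> space M" for \<omega>
    using arm_types[OF ij(1) that] that by (auto simp: B_def indicator_def rewards_def)
  show "integrable M (\<lambda>\<omega>. indicator (pulled n i j) \<omega> * (\<mu> 1 - rewards \<kappa> Y \<omega> i j))"
    using Bochner_Integration.integrable_add[OF int[of 1] int[of 2]]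
    by (subst Bochner_Integration.integrable_cong[OF refl split]) auto
  show "expectation (\<lambda>\<omega>. indicator (pulled n i j) \<omega> * (\<mu> 1 - rewards \<kappa> Y \<omega> i j)) = (\<mu> 1 - \<mu> 2) * prob (B 2)"
    using int[of 1] int[of 2] E[of 1] E[of 2]
    by (subst Bochner_Integration.integral_cong[OF refl split]) auto
qed

text \<open>Arms and numbers of pulls are at most \<open>n\<close>, so a sum over plays is a sum
  over a fixed grid with indicators. The regrouping is used twice, forward for the rewards and
  backward for the types, with the expectation evaluated pair by pair in between.\<close>

lemma expected_regret:
  "expectation (alg2_regret \<mu> \<kappa> Y Z U tie n)
    = (\<mu> 1 - \<mu> 2) * expectation (\<lambda>\<omega>. \<Sum>t=1..n. of_bool (\<kappa> (play \<omega> t) \<omega> = 2))"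
proof -
  define B where "B = (\<lambda>i j. pulled n i j \<inter> {\<omega> \<in> space M. \<kappa> i \<omega> = 2})"
  have pulls: "(\<Sum>t=1..n. g (play \<omega> t) (num_pulls (play \<omega>) (play \<omega> t) t))
      = (\<Sum>i=1..n. \<Sum>j=1..n. indicator (pulled n i j) \<omega> * g i j)"
    if "\<omega> \<in> space M" for g :: "nat \<Rightarrow> nat \<Rightarrow> real" and \<omega>
  proof -
    have "(\<Sum>t=1..n. g (play \<omega> t) (num_pulls (play \<omega>) (play \<omega> t) t))
        = (\<Sum>i=1..n. \<Sum>j=1..num_pulls (play \<omega>) i n. g i j)"
    proof (rule sum_over_pulls)
      fix t assume "1 \<le> t" "t \<le> n"
      then show "play \<omega> t \<in> {1..n}" using play_bounds[of t \<omega>] by auto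
    qed simp
    also have "\<dots> = (\<Sum>i=1..n. \<Sum>j=1..n. indicator (pulled n i j) \<omega> * g i j)"
    proof (rule sum.cong[OF refl])
      fix i
      show "(\<Sum>j=1..num_pulls (play \<omega>) i n. g i j) = (\<Sum>j=1..n. indicator (pulled n i j) \<omega> * g i j)"
        using num_pulls_le[of "play \<omega>" i n] that
        by (intro sum.mono_neutral_cong_left) (auto simp: pulled_def indicator_def)
    qed
    finally show ?thesis .
  qed
  have lin: "expectation (\<lambda>\<omega>. \<Sum>i=1..n. \<Sum>j=1..n. h i j \<omega>) = (\<Sum>i=1..n. \<Sum>j=1..n. expectation (h i j))"
    if "\<And>i j. 1 \<le> i \<Longrightarrow> 1 \<le> j \<Longrightarrow> integrable M (h i j)" for h :: "nat \<Rightarrow> nat \<Rightarrow> 'a \<Rightarrow> real"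
    using that by (subst Bochner_Integration.integral_sum)
      (auto intro!: sum.cong Bochner_Integration.integral_sum Bochner_Integration.integrable_sum)
  have "expectation (alg2_regret \<mu> \<kappa> Y Z U tie n)
      = expectation (\<lambda>\<omega>. \<Sum>i=1..n. \<Sum>j=1..n. indicator (pulled n i j) \<omega> * (\<mu> 1 - rewards \<kappa> Y \<omega> i j))"
  proof (rule Bochner_Integration.integral_cong[OF refl])
    fix \<omega> assume "\<omega> \<in> space M"
    from pulls[OF this, of "\<lambda>i j. \<mu> 1 - rewards \<kappa> Y \<omega> i j"]
    show "alg2_regret \<mu> \<kappa> Y Z U tie n \<omega>
        = (\<Sum>i=1..n. \<Sum>j=1..n. indicator (pulled n i j) \<omega> * (\<mu> 1 - rewards \<kappa> Y \<omega> i j))"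
      by (simp only: alg2_regret_def regret_def play_def Let_def)
  qed
  also have "\<dots> = (\<Sum>i=1..n. \<Sum>j=1..n. (\<mu> 1 - \<mu> 2) * prob (B i j))"
    using expectation_pull by (subst lin) (auto simp: B_def intro!: sum.cong)
  also have "\<dots> = (\<mu> 1 - \<mu> 2) * (\<Sum>i=1..n. \<Sum>j=1..n. expectation (indicator (B i j)))"
    using expectation_pull(3) by (simp add: sum_distrib_left B_def)
  also have "(\<Sum>i=1..n. \<Sum>j=1..n. expectation (indicator (B i j)))
      = expectation (\<lambda>\<omega>. \<Sum>i=1..n. \<Sum>j=1..n. indicator (B i j) \<omega> :: real)"
    using expectation_pull(3) by (intro lin[symmetric]) (simp add: B_def emeasure_eq_measure)
  also have "\<dots> = expectation (\<lambda>\<omega>. \<Sum>t=1..n. of_bool (\<kappa> (play \<omega> t) \<omega> = 2))"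
  proof (rule Bochner_Integration.integral_cong[OF refl])
    fix \<omega> assume \<omega>: "\<omega> \<in> space M"
    have "(\<Sum>i=1..n. \<Sum>j=1..n. indicator (B i j) \<omega> :: real)
        = (\<Sum>i=1..n. \<Sum>j=1..n. indicator (pulled n i j) \<omega> * of_bool (\<kappa> i \<omega> = 2))"
      using \<omega> by (intro sum.cong refl) (auto simp: B_def indicator_def)
    then show "(\<Sum>i=1..n. \<Sum>j=1..n. indicator (B i j) \<omega> :: real) = (\<Sum>t=1..n. of_bool (\<kappa> (play \<omega> t) \<omega> = 2))"
      using pulls[OF \<omega>, of "\<lambda>i j. of_bool (\<kappa> i \<omega> = 2)"] by simp
  qed
  finally show ?thesis .
qed

end

section \<open>Concentration\<close>

lemma sum_inverse_squares_le: "(\<Sum>m=2..n. 1 / (real m)\<^sup>2) \<le> 1"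
proof -
  have "(\<Sum>m=2..n. 1 / (real m)\<^sup>2) \<le> 1 - 1 / real n" if "1 \<le> n"
    using that
  proof (induction n rule: dec_induct)
    case (step n)
    have "1 / (real (Suc n))\<^sup>2 \<le> 1 / (real n * real (Suc n))"
      using step by (intro divide_left_mono) (auto simp: power2_eq_square)
    also have "\<dots> = 1 / real n - 1 / real (Suc n)"
      using step by (simp add: field_simps)
    finally have *: "1 / (real (Suc n))\<^sup>2 \<le> 1 / real n - 1 / real (Suc n)" .
    have "(\<Sum>m=2..Suc n. 1 / (real m)\<^sup>2) = (\<Sum>m=2..n. 1 / (real m)\<^sup>2) + 1 / (real (Suc n))\<^sup>2"
      using step(1) by (simp add: numeral_2_eq_2)
    then show ?case using step.IH * by linarith
  qed simp
  then show ?thesis by (cases "n = 0") (auto intro: order_trans)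
qed

lemma exp_ln_le_inverse_power:
  assumes "1 \<le> (T::nat)" "real p \<le> a"
  shows "exp (- (a * ln (real T))) \<le> 1 / real T ^ p"
proof -
  have "exp (- (a * ln (real T))) \<le> exp (- (real p * ln (real T)))"
    using assms by (simp add: mult_right_mono)
  also have "\<dots> = 1 / real T ^ p"
    using assms by (simp add: exp_minus exp_of_nat_mult field_simps)
  finally show ?thesis .
qed

text \<open>After squaring, the claim reads \<open>a * ln m <= m\<close> with
  \<open>a = 64 / \<Delta>\<^sup>2\<close>. Linearising the logarithm at
  \<open>a * L\<^sup>2\<close> reduces it to \<open>3 * L - 3 <= L\<^sup>2 - 1\<close>, that is
  \<open>0 <= (L - 1) * (L - 2)\<close>; hence the squared logarithm in \<open>T0\<close>. The
  factor 8 is twice that of the threshold, which leaves one threshold for the fluctuations of the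
  rewards.\<close>

lemma linear_ge_sqrt_log:
  assumes \<Delta>: "0 < \<Delta>" "\<Delta> \<le> 1" and m: "real_of_int (T0 \<Delta>) \<le> real m"
  shows "8 * sqrt (real m * ln (real m)) \<le> real m * \<Delta>" and "3 \<le> T0 \<Delta>"
proof -
  define a L where "a = 64 / \<Delta>\<^sup>2" and "L = ln a"
  have "\<Delta>\<^sup>2 \<le> 1" using \<Delta> by (simp add: power_le_one)
  then have a: "64 \<le> a" using \<Delta> by (simp add: a_def field_simps)
  have "ln (64::real) = 6 * ln 2" using ln_realpow[of "2::real" 6] by simp
  then have "4 \<le> ln (64::real)" using ln2_ge_two_thirds by linarith
  also have "\<dots> \<le> L" using a by (simp add: L_def)
  finally have L: "4 \<le> L" .
  have L2: "16 \<le> L\<^sup>2" using L power_mono[of 4 L 2] by simp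
  have T0: "a * L\<^sup>2 \<le> real_of_int (T0 \<Delta>)" unfolding T0_def a_def L_def by linarith
  have "64 * 16 \<le> a * L\<^sup>2" using a L2 by (intro mult_mono) auto
  then show "3 \<le> T0 \<Delta>" using T0 by linarith
  have mL: "a * L\<^sup>2 \<le> real m" using T0 m by linarith
  have aL: "0 < a * L\<^sup>2" using a L by simp
  have m0: "0 < real m" using mL aL by linarith
  have "ln (real m) = ln (real m / (a * L\<^sup>2)) + ln (a * L\<^sup>2)"
    using m0 aL ln_div[of "real m" "a * L\<^sup>2"] by auto
  also have "ln (real m / (a * L\<^sup>2)) \<le> real m / (a * L\<^sup>2) - 1"
    using m0 aL by (intro ln_le_minus_one) simp
  also have "ln (a * L\<^sup>2) = L + 2 * ln L"
    using a L by (simp add: ln_mult ln_realpow L_def)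
  also have "ln L \<le> L - 1" using L by (intro ln_le_minus_one) simp
  finally have "ln (real m) \<le> real m / (a * L\<^sup>2) + 3 * L - 3" by simp
  then have "a * ln (real m) \<le> a * (real m / (a * L\<^sup>2) + 3 * L - 3)"
    using a by (intro mult_left_mono) auto
  also have "\<dots> = real m / L\<^sup>2 + a * (3 * L - 3)"
    using a by (simp add: field_simps)
  also have "a * (3 * L - 3) \<le> a * (L\<^sup>2 - 1)"
  proof -
    have "0 \<le> (L - 1) * (L - 2)" using L by simp
    then show ?thesis using a by (intro mult_left_mono) (auto simp: power2_eq_square algebra_simps)
  qed
  \<comment> \<open>Written this way, the constant term is absorbed by \<open>m\<close>, and the two
    shares \<open>1 / L\<^sup>2\<close> and \<open>1 - 1 / L\<^sup>2\<close> of \<open>m\<close> add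
    up to \<open>m\<close>.\<close>
  also have "a * (L\<^sup>2 - 1) = a * L\<^sup>2 * (1 - 1 / L\<^sup>2)"
    using L by (simp add: field_simps)
  also have "\<dots> \<le> real m * (1 - 1 / L\<^sup>2)"
  proof (rule mult_right_mono[OF mL])
    show "0 \<le> 1 - 1 / L\<^sup>2" using L2 by (simp add: divide_le_eq)
  qed
  finally have "a * ln (real m) \<le> real m" by (simp add: algebra_simps)
  then have "64 * ln (real m) \<le> real m * \<Delta>\<^sup>2"
    using \<Delta> by (simp add: a_def field_simps)
  then have "64 * (real m * ln (real m)) \<le> (real m * \<Delta>)\<^sup>2"
    using mult_left_mono[of "64 * ln (real m)" "real m * \<Delta>\<^sup>2" "real m"] by (simp add: power2_eq_square algebra_simps)
  then have "sqrt (64 * (real m * ln (real m))) \<le> real m * \<Delta>"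
    using m0 \<Delta> by (intro real_le_lsqrt) auto
  then show "8 * sqrt (real m * ln (real m)) \<le> real m * \<Delta>"
    by (simp add: real_sqrt_mult)
qed

lemma Phi_bar_eq: "Phi_bar v = (\<integral>u. std_normal_density u * indicator {v..} u \<partial>lborel)"
  unfolding Phi_bar_def set_lebesgue_integral_def std_normal_density_def
  by (subst integral_mult_right_zero[symmetric]) (simp add: ac_simps)

lemma Phi_bar_pos:
  assumes "0 \<le> v"
  shows "0 < Phi_bar v"
proof -
  \<comment> \<open>The density decreases on the nonnegative reals, so \<open>c\<close> is its
    minimum on the interval from \<open>v\<close> to \<open>v + 1\<close>.\<close>
  define c where "c = std_normal_density (v + 1)"
  have "0 < c" by (simp add: c_def std_normal_density_def)
  also have "c = (\<integral>u. c * indicator {v..v + 1} u \<partial>lborel)" by simp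
  also have "\<dots> \<le> (\<integral>u. std_normal_density u * indicator {v..} u \<partial>lborel)"
  proof (rule integral_mono)
    show "integrable lborel (\<lambda>u. c * indicator {v..v + 1} u)" by simp
    show "integrable lborel (\<lambda>u. std_normal_density u * indicator {v..} u)"
      using integrable_std_normal_moment[of 0] by (intro integrable_real_mult_indicator) auto
    fix u :: real
    have "c \<le> std_normal_density u" if "u \<in> {v..v + 1}"
    proof -
      have "u\<^sup>2 \<le> (v + 1)\<^sup>2" using that assms by (intro power_mono) auto
      then show ?thesis by (simp add: c_def std_normal_density_def divide_right_mono)
    qed
    then show "c * indicator {v..v + 1} u \<le> std_normal_density u * indicator {v..} u"
      by (auto simp: indicator_def)
  qed
  finally show ?thesis by (simp add: Phi_bar_eq)
qed

lemma measurable_deviates: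
  assumes "\<And>j. 1 \<le> j \<Longrightarrow> (\<lambda>\<omega>. r \<omega> j) \<in> borel_measurable N"
  shows "Measurable.pred N (\<lambda>\<omega>. deviates (r \<omega>) m T)"
proof -
  have [measurable]: "(\<lambda>\<omega>. \<Sum>j=1..k. r \<omega> j) \<in> borel_measurable N" for k
    using assms by (intro borel_measurable_sum) auto
  show ?thesis unfolding deviates_def by measurable
qed

lemma measurable_discard_test:
  assumes "\<And>i j. i \<in> {s, Suc s} \<Longrightarrow> 1 \<le> j \<Longrightarrow> (\<lambda>\<omega>. x \<omega> i j) \<in> borel_measurable N"
    and [measurable]: "\<zeta> \<in> borel_measurable N"
  shows "Measurable.pred N (\<lambda>\<omega>. discard_test (x \<omega>) (\<zeta> \<omega>) s m)"
proof -
  have [measurable]: "(\<lambda>\<omega>. \<Sum>j=1..m. x \<omega> s j - x \<omega> (s + 1) j) \<in> borel_measurable N"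
    using assms(1) by (intro borel_measurable_sum borel_measurable_diff) auto
  show ?thesis unfolding discard_test_def by measurable
qed

section \<open>Hoeffding bounds for the rewards\<close>

context alg2_bandit
begin

lemma mean_in_unit: "k \<in> {1, 2} \<Longrightarrow> \<mu> k \<in> {0..1}"
proof -
  assume k: "k \<in> {1, 2}"
  have r: "Y k 1 1 \<omega> \<in> {0..1}" if "\<omega> \<in> space M" for \<omega> using reward_range[OF k _ _ that, of 1 1] by simp
  have "0 \<le> expectation (Y k 1 1)" using r by (intro Bochner_Integration.integral_nonneg) auto
  moreover have "expectation (Y k 1 1) \<le> 1"
    using reward_integrable[OF k, of 1 1] r by (intro integral_le_const) auto
  ultimately show ?thesis using reward_mean[OF k, of 1 1] by simp
qed

text \<open>The signs put upper tails, lower tails and differences of two arms into one statement; a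
  signed reward still ranges over an interval of length 1.\<close>

lemma reward_sum_tail:
  assumes J: "finite J" "J \<noteq> {}" "\<And>r. r \<in> J \<Longrightarrow> \<exists>k i j. r = Reward_of k i j \<and> k \<in> {1, 2} \<and> 1 \<le> i \<and> 1 \<le> j"
    and \<sigma>: "\<And>r. r \<in> J \<Longrightarrow> \<sigma> r \<in> {1, -1}" and "0 \<le> \<epsilon>"
  shows "prob {\<omega> \<in> space M. (\<Sum>r\<in>J. \<sigma> r * X r \<omega>) \<ge> (\<Sum>r\<in>J. \<sigma> r * expectation (X r)) + \<epsilon>}
    \<le> exp (- 2 * \<epsilon>\<^sup>2 / real (card J))"
proof -
  have sub: "J \<subseteq> sources" using J(3) by (force simp: sources_def)
  have range: "X r \<omega> \<in> {0..1}" if "r \<in> J" "\<omega> \<in> space M" for r \<omega>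
    using J(3)[OF that(1)] reward_range[OF _ _ _ that(2)] by auto
  interpret Hoeffding_ineq M J "\<lambda>r \<omega>. \<sigma> r * X r \<omega>" "\<lambda>r. min 0 (\<sigma> r)" "\<lambda>r. max 0 (\<sigma> r)"
    "\<Sum>r\<in>J. expectation (\<lambda>\<omega>. \<sigma> r * X r \<omega>)"
  proof unfold_locales
    show "indep_vars (\<lambda>_. borel) (\<lambda>r \<omega>. \<sigma> r * X r \<omega>) J"
      by (rule indep_vars_compose2[OF indep_vars_subset[OF independent sub]]) auto
    show "AE \<omega> in M. \<sigma> r * X r \<omega> \<in> {min 0 (\<sigma> r)..max 0 (\<sigma> r)}" if "r \<in> J" for r
      using range[OF that] \<sigma>[OF that] by (intro AE_I2) auto
  qed (use J in auto)
  have card: "(\<Sum>r\<in>J. (max 0 (\<sigma> r) - min 0 (\<sigma> r))\<^sup>2) = real (card J)"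
  proof -
    have "(\<Sum>r\<in>J. (max 0 (\<sigma> r) - min 0 (\<sigma> r))\<^sup>2) = (\<Sum>r\<in>J. 1)"
    proof (rule sum.cong[OF refl])
      fix r assume "r \<in> J"
      from \<sigma>[OF this] show "(max 0 (\<sigma> r) - min 0 (\<sigma> r))\<^sup>2 = 1" by auto
    qed
    then show ?thesis by simp
  qed
  show ?thesis
    using Hoeffding_ineq_ge[OF \<open>0 \<le> \<epsilon>\<close>] J(1,2) unfolding card by (simp add: card_gt_0_iff)
qed

lemma mean_tail:
  assumes "k \<in> {1, 2}" "1 \<le> i" "1 \<le> m" "c \<in> {1, -1}" "0 \<le> \<epsilon>"
  shows "prob {\<omega> \<in> space M. c * ((\<Sum>j=1..m. Y k i j \<omega>) - real m * \<mu> k) \<ge> \<epsilon>} \<le> exp (- 2 * \<epsilon>\<^sup>2 / real m)"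
proof -
  let ?J = "Reward_of k i ` {1..m}"
  have inj: "inj_on (Reward_of k i) {1..m}" by (auto simp: inj_on_def)
  have "prob {\<omega> \<in> space M. (\<Sum>r\<in>?J. c * X r \<omega>) \<ge> (\<Sum>r\<in>?J. c * expectation (X r)) + \<epsilon>}
    \<le> exp (- 2 * \<epsilon>\<^sup>2 / real (card ?J))"
    using assms by (intro reward_sum_tail) auto
  moreover have "(\<Sum>r\<in>?J. c * X r \<omega>) = c * (\<Sum>j=1..m. Y k i j \<omega>)" for \<omega>
    by (subst sum.reindex[OF inj]) (simp add: sum_distrib_left)
  moreover have "(\<Sum>r\<in>?J. c * expectation (X r)) = c * (real m * \<mu> k)"
    using assms by (subst sum.reindex[OF inj]) (simp add: reward_mean)
  ultimately show ?thesis
    using inj by (simp add: card_image algebra_simps)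
qed

text \<open>The difference of two arms is a signed sum of \<open>2 * m\<close> independent rewards,
  which halves the exponent compared with a single arm.\<close>

lemma difference_tail:
  assumes k: "k \<in> {1, 2}" and l: "l \<in> {1, 2}" and "1 \<le> s" "1 \<le> m" "c \<in> {1, -1}" "0 \<le> \<epsilon>"
  shows "prob {\<omega> \<in> space M. c * ((\<Sum>j=1..m. Y k s j \<omega> - Y l (Suc s) j \<omega>) - real m * (\<mu> k - \<mu> l)) \<ge> \<epsilon>}
    \<le> exp (- \<epsilon>\<^sup>2 / real m)"
proof -
  let ?A = "Reward_of k s ` {1..m}" and ?B = "Reward_of l (Suc s) ` {1..m}"
  define \<sigma> where "\<sigma> = (\<lambda>r. if r \<in> ?A then c else - c)"
  have inj: "inj_on (Reward_of k s) {1..m}" "inj_on (Reward_of l (Suc s)) {1..m}" by (auto simp: inj_on_def)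
  have disj: "?A \<inter> ?B = {}" by auto
  have \<sigma>B: "\<sigma> r = - c" if "r \<in> ?B" for r using that by (auto simp: \<sigma>_def)
  have sum: "(\<Sum>r\<in>?A \<union> ?B. \<sigma> r * f r) = c * (\<Sum>j=1..m. f (Reward_of k s j) - f (Reward_of l (Suc s) j))" for f
  proof -
    have "(\<Sum>r\<in>?A \<union> ?B. \<sigma> r * f r) = (\<Sum>r\<in>?A. c * f r) + (\<Sum>r\<in>?B. - c * f r)"
      by (subst sum.union_disjoint[OF _ _ disj]) (auto simp: \<sigma>_def intro!: arg_cong2[where f = "(+)"] sum.cong)
    also have "\<dots> = (\<Sum>j=1..m. c * f (Reward_of k s j)) + (\<Sum>j=1..m. - c * f (Reward_of l (Suc s) j))"
      by (subst (1 2) sum.reindex) (use inj in auto)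
    finally show ?thesis
      by (simp add: sum_distrib_left sum_subtractf sum_negf right_diff_distrib)
  qed
  have card: "card (?A \<union> ?B) = 2 * m"
    using inj by (subst card_Un_disjoint[OF _ _ disj]) (auto simp: card_image)
  have "prob {\<omega> \<in> space M. (\<Sum>r\<in>?A \<union> ?B. \<sigma> r * X r \<omega>) \<ge> (\<Sum>r\<in>?A \<union> ?B. \<sigma> r * expectation (X r)) + \<epsilon>}
    \<le> exp (- 2 * \<epsilon>\<^sup>2 / real (card (?A \<union> ?B)))"
  proof (rule reward_sum_tail)
    show "\<sigma> r \<in> {1, - 1}" for r using assms by (auto simp: \<sigma>_def)
    show "\<exists>k i j. r = Reward_of k i j \<and> k \<in> {1, 2} \<and> 1 \<le> i \<and> 1 \<le> j" if "r \<in> ?A \<union> ?B" for r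
      using that assms by auto
  qed (use assms in auto)
  moreover have E: "(\<Sum>j=1..m. expectation (X (Reward_of k s j)) - expectation (X (Reward_of l (Suc s) j))) = real m * (\<mu> k - \<mu> l)"
    using assms by (simp add: reward_mean)
  moreover have "\<epsilon> \<le> c * (S - r) \<longleftrightarrow> c * r + \<epsilon> \<le> c * S" for S r
    by (auto simp: right_diff_distrib)
  ultimately show ?thesis
    unfolding sum card E by simp
qed

text \<open>The number of pulls at which the run evaluates an average is random, so a union bound
  over all values up to \<open>T\<close> and both signs is taken. The radius gives the exponent
  \<open>2 * 2 * (7/8)^2 = 49/16\<close>, which exceeds 3; hence \<open>2 * T\<close> terms of size
  at most \<open>1 / T^3\<close>.\<close>

lemma prob_deviates:
  assumes k: "k \<in> {1, 2}" and i: "1 \<le> i" and T: "2 \<le> T"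
  shows "prob {\<omega> \<in> space M. deviates (\<lambda>j. Y k i j \<omega>) (\<mu> k) T} \<le> 2 / (real T)\<^sup>2"
proof -
  define \<epsilon> where "\<epsilon> q = real q * (7 / 8 * sqrt (2 * ln (real T) / real q))" for q
  define A where "A c q = {\<omega> \<in> space M. c * ((\<Sum>j=1..q. Y k i j \<omega>) - real q * \<mu> k) \<ge> \<epsilon> q}" for c :: real and q
  have Ym: "Y k i j \<in> borel_measurable M" if "1 \<le> j" for j
    using reward_integrable[OF k i that] by (rule borel_measurable_integrable)
  have [measurable]: "(\<lambda>\<omega>. \<Sum>j=1..q. Y k i j \<omega>) \<in> borel_measurable M" for q
    using Ym by (intro borel_measurable_sum) auto
  have A: "A c q \<in> events" for c q unfolding A_def by measurable
  have PA: "prob (A c q) \<le> 1 / real T ^ 3" if "q \<in> {1..T}" "c \<in> {1, -1}" for c q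
  proof -
    have "prob (A c q) \<le> exp (- 2 * (\<epsilon> q)\<^sup>2 / real q)"
      unfolding A_def using that k i T by (intro mean_tail) (auto simp: \<epsilon>_def)
    also have "- 2 * (\<epsilon> q)\<^sup>2 / real q = - (49 / 16 * ln (real T))"
      using that T by (simp add: \<epsilon>_def power_mult_distrib) (simp add: power2_eq_square field_simps)
    also have "exp \<dots> \<le> 1 / real T ^ 3"
      using T by (intro exp_ln_le_inverse_power) auto
    finally show ?thesis .
  qed
  have "{\<omega> \<in> space M. deviates (\<lambda>j. Y k i j \<omega>) (\<mu> k) T} \<subseteq> (\<Union>q\<in>{1..T}. A 1 q \<union> A (-1) q)"
  proof
    fix \<omega> assume "\<omega> \<in> {\<omega> \<in> space M. deviates (\<lambda>j. Y k i j \<omega>) (\<mu> k) T}"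
    then obtain q where \<omega>: "\<omega> \<in> space M" and q: "q \<in> {1..T}"
      and dev: "7 / 8 * sqrt (2 * ln (real T) / real q) \<le> \<bar>(\<Sum>j=1..q. Y k i j \<omega>) / real q - \<mu> k\<bar>"
      by (auto simp: deviates_def)
    have "\<epsilon> q \<le> real q * \<bar>(\<Sum>j=1..q. Y k i j \<omega>) / real q - \<mu> k\<bar>"
      unfolding \<epsilon>_def using dev by (intro mult_left_mono) auto
    also have "\<dots> = \<bar>real q * ((\<Sum>j=1..q. Y k i j \<omega>) / real q - \<mu> k)\<bar>" by (simp add: abs_mult)
    also have "real q * ((\<Sum>j=1..q. Y k i j \<omega>) / real q - \<mu> k) = (\<Sum>j=1..q. Y k i j \<omega>) - real q * \<mu> k"
      using q by (simp add: field_simps)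
    finally show "\<omega> \<in> (\<Union>q\<in>{1..T}. A 1 q \<union> A (-1) q)"
      using \<omega> q by (auto simp: A_def abs_if split: if_splits)
  qed
  then have "prob {\<omega> \<in> space M. deviates (\<lambda>j. Y k i j \<omega>) (\<mu> k) T} \<le> prob (\<Union>q\<in>{1..T}. A 1 q \<union> A (-1) q)"
    using A by (intro finite_measure_mono) auto
  also have "\<dots> \<le> (\<Sum>q\<in>{1..T}. prob (A 1 q \<union> A (-1) q))"
    using A by (intro finite_measure_subadditive_finite) auto
  also have "\<dots> \<le> (\<Sum>q\<in>{1..T}. 1 / real T ^ 3 + 1 / real T ^ 3)"
    using A PA by (intro sum_mono order_trans[OF measure_Un_le] add_mono) auto
  also have "\<dots> = 2 / (real T)\<^sup>2"
    using T by (simp add: power2_eq_square power3_eq_cube)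
  finally show ?thesis .
qed

lemma expectation_deviation_count:
  assumes "k \<in> {1, 2}" "1 \<le> i"
  shows "expectation (\<lambda>\<omega>. real (deviation_count (\<lambda>j. Y k i j \<omega>) (\<mu> k) n)) \<le> 2"
proof -
  define D where "D T = {\<omega> \<in> space M. deviates (\<lambda>j. Y k i j \<omega>) (\<mu> k) T}" for T
  have "Y k i j \<in> borel_measurable M" if "1 \<le> j" for j
    using reward_integrable[OF assms that] by (rule borel_measurable_integrable)
  then have D: "D T \<in> events" for T
    using measurable_deviates[of "\<lambda>\<omega> j. Y k i j \<omega>" M "\<mu> k" T] by (simp add: D_def pred_def)
  have "expectation (\<lambda>\<omega>. real (deviation_count (\<lambda>j. Y k i j \<omega>) (\<mu> k) n)) = expectation (\<lambda>\<omega>. \<Sum>T=2..n. indicator (D T) \<omega>)"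
  proof (rule Bochner_Integration.integral_cong[OF refl])
    fix \<omega> assume "\<omega> \<in> space M"
    then show "real (deviation_count (\<lambda>j. Y k i j \<omega>) (\<mu> k) n) = (\<Sum>T=2..n. indicator (D T) \<omega>)"
      by (simp add: deviation_count_def D_def indicator_def sum.If_cases Int_def)
  qed
  also have "\<dots> = (\<Sum>T=2..n. prob (D T))" using D by (simp add: emeasure_eq_measure)
  also have "\<dots> \<le> (\<Sum>T=2..n. 2 * (1 / (real T)\<^sup>2))"
    unfolding D_def using prob_deviates[OF assms] by (intro sum_mono) auto
  also have "\<dots> \<le> 2" using sum_inverse_squares_le[of n] by (simp only: sum_distrib_left[symmetric])
  finally show ?thesis .
qed


definition future :: "nat \<Rightarrow> source set" where
  "future s = {Reward_of k i j | k i j. k \<in> {1, 2} \<and> i \<in> {s, Suc s} \<and> j \<ge> 1} \<union> {Gauss s}"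

text \<open>Types enter as parameters rather than random variables, so whatever is built from these
  rewards and the sample depends on \<open>future s\<close> alone. On the event that the arms
  \<open>s\<close> and \<open>Suc s\<close> have types \<open>k\<close> and \<open>l\<close>, these
  are their true rewards.\<close>

definition typed_rewards :: "nat \<Rightarrow> nat \<Rightarrow> nat \<Rightarrow> 'a \<Rightarrow> nat \<Rightarrow> nat \<Rightarrow> real" where
  "typed_rewards k l s \<omega> i j = (if i = s then Y k i j \<omega> else Y l i j \<omega>)"

lemma future_subset: "1 \<le> s \<Longrightarrow> future s \<subseteq> sources"
  by (auto simp: future_def sources_def)

lemma Z_generated: "Z s \<in> borel_measurable (generated (future s))"
  using X_measurable_generated[of "Gauss s" "future s"] by (simp add: future_def)

lemma Z_squared:
  assumes "1 \<le> s"
  shows "integrable M (\<lambda>\<omega>. (Z s \<omega>)\<^sup>2)" and "expectation (\<lambda>\<omega>. (Z s \<omega>)\<^sup>2) = 1"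
proof -
  show "integrable M (\<lambda>\<omega>. (Z s \<omega>)\<^sup>2)"
    using distributed_integrable[OF gauss[OF assms], of "\<lambda>u. u\<^sup>2"] integrable_std_normal_moment[of 2] by simp
  show "expectation (\<lambda>\<omega>. (Z s \<omega>)\<^sup>2) = 1"
    using distributed_integral[OF gauss[OF assms], of "\<lambda>u. u\<^sup>2"] integral_std_normal_moment_even[of 1] by simp
qed

lemma gauss_tail:
  assumes "1 \<le> s" "c \<in> {1, -1}"
  shows "prob {\<omega> \<in> space M. v \<le> c * Z s \<omega>} = Phi_bar v"
proof -
  have D: "distributed M lborel (\<lambda>\<omega>. c * Z s \<omega>) std_normal_density"
    using normal_density_affine[OF gauss[OF assms(1)], of c 0] assms(2) by auto
  have "Phi_bar v = expectation (\<lambda>\<omega>. indicator {v..} (c * Z s \<omega>))"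
    unfolding Phi_bar_eq by (rule distributed_integral[OF D]) auto
  also have "\<dots> = expectation (indicator {\<omega> \<in> space M. v \<le> c * Z s \<omega>})"
    by (rule Bochner_Integration.integral_cong) (auto simp: indicator_def)
  also have "\<dots> = prob {\<omega> \<in> space M. v \<le> c * Z s \<omega>}"
    using distributed_measurable[OF D] by simp
  finally show ?thesis by simp
qed

lemma differences_measurable:
  fixes s k l m :: nat
  assumes "k \<in> {1, 2}" "l \<in> {1, 2}"
  defines "J \<equiv> future s - {Gauss s}"
  shows "(\<lambda>\<omega>. \<Sum>j=1..m. Y k s j \<omega> - Y l (Suc s) j \<omega>) \<in> borel_measurable (generated J)"
proof (rule borel_measurable_sum)
  fix j assume "j \<in> {1..m}"
  then have "Reward_of k s j \<in> J" "Reward_of l (Suc s) j \<in> J" using assms by (auto simp: future_def)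
  then show "(\<lambda>\<omega>. Y k s j \<omega> - Y l (Suc s) j \<omega>) \<in> borel_measurable (generated J)"
    by (intro borel_measurable_diff reward_generated)
qed

lemma generated_mono: "J \<subseteq> K \<Longrightarrow> sets (generated J) \<subseteq> sets (generated K)"
  unfolding sets_generated by (intro sigma_sets_mono') auto

text \<open>The threshold 4 is split as 3 + 1: passing the test at \<open>m\<close> needs either a
  reward sum of modulus at least \<open>3 * sqrt (m * ln m)\<close> or a sample of modulus at least
  \<open>sqrt (m * ln m)\<close>. The first has summable probability. For \<open>m\<close> at least
  3 the logarithm is at least 1, so the second forces \<open>m\<close> to be at most the squared
  sample, whose mean is 1. The sizes 1 and 2 are counted in full, and the total is
  \<open>2 + 1 + 2 = 5\<close>.\<close>

lemma expectation_survival_count: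
  assumes k: "k \<in> {1, 2}" and s: "1 \<le> s"
  shows "expectation (\<lambda>\<omega>. real (survival_count (typed_rewards k k s \<omega>) (Z s \<omega>) s n)) \<le> 5"
proof -
  define S where "S = (\<lambda>m \<omega>. \<Sum>j=1..m. Y k s j \<omega> - Y k (Suc s) j \<omega>)"
  define \<epsilon> where "\<epsilon> = (\<lambda>m::nat. 3 * sqrt (real m * ln (real m)))"
  define D where "D m = {\<omega> \<in> space M. \<epsilon> m \<le> \<bar>S m \<omega>\<bar>}" for m
  have Sm [measurable]: "S m \<in> borel_measurable M" for m
    using generated_measurable[OF _ differences_measurable[OF k k, of s m]] future_subset[OF s]
    by (auto simp: S_def)
  have D: "D m \<in> events" for m unfolding D_def by measurable
  have PD: "prob (D m) \<le> 2 * (1 / (real m)\<^sup>2)" if m: "m \<in> {2..n}" for m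
  proof -
    have "prob {\<omega> \<in> space M. c * S m \<omega> \<ge> \<epsilon> m} \<le> 1 / (real m)\<^sup>2" if c: "c \<in> {1, -1}" for c
    proof -
      have "prob {\<omega> \<in> space M. c * S m \<omega> \<ge> \<epsilon> m} \<le> exp (- (\<epsilon> m)\<^sup>2 / real m)"
        using difference_tail[OF k k s _ c, of m "\<epsilon> m"] m by (simp add: S_def \<epsilon>_def)
      also have "- (\<epsilon> m)\<^sup>2 / real m = - (9 * ln (real m))"
        using m by (simp add: \<epsilon>_def power_mult_distrib)
      also have "exp \<dots> \<le> 1 / (real m)\<^sup>2" using m by (intro exp_ln_le_inverse_power) auto
      finally show ?thesis .
    qed
    from this[of 1] this[of "-1"]
    have "prob {\<omega> \<in> space M. S m \<omega> \<ge> \<epsilon> m} + prob {\<omega> \<in> space M. - S m \<omega> \<ge> \<epsilon> m} \<le> 2 * (1 / (real m)\<^sup>2)"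
      by simp
    moreover have "D m = {\<omega> \<in> space M. S m \<omega> \<ge> \<epsilon> m} \<union> {\<omega> \<in> space M. - S m \<omega> \<ge> \<epsilon> m}"
      by (auto simp: D_def abs_if split: if_splits)
    moreover have "prob ({\<omega> \<in> space M. S m \<omega> \<ge> \<epsilon> m} \<union> {\<omega> \<in> space M. - S m \<omega> \<ge> \<epsilon> m})
        \<le> prob {\<omega> \<in> space M. S m \<omega> \<ge> \<epsilon> m} + prob {\<omega> \<in> space M. - S m \<omega> \<ge> \<epsilon> m}"
      by (rule measure_Un_le) measurable
    ultimately show ?thesis by simp
  qed
  have bound: "real (survival_count (typed_rewards k k s \<omega>) (Z s \<omega>) s n)
      \<le> 2 + (Z s \<omega>)\<^sup>2 + (\<Sum>m=2..n. indicator (D m) \<omega>)" if \<omega>: "\<omega> \<in> space M" for \<omega>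
  proof -
    define q where "q = nat \<lfloor>(Z s \<omega>)\<^sup>2\<rfloor>"
    have "{m \<in> {1..n}. \<not> discard_test (typed_rewards k k s \<omega>) (Z s \<omega>) s m}
      \<subseteq> {1, 2} \<union> {1..q} \<union> {m \<in> {2..n}. \<omega> \<in> D m}"
    proof
      fix m assume m: "m \<in> {m \<in> {1..n}. \<not> discard_test (typed_rewards k k s \<omega>) (Z s \<omega>) s m}"
      show "m \<in> {1, 2} \<union> {1..q} \<union> {m \<in> {2..n}. \<omega> \<in> D m}"
      proof (cases "m \<le> 2 \<or> \<omega> \<in> D m")
        case True
        then show ?thesis using m by auto
      next
        case False
        then have m3: "3 \<le> m" and S: "\<bar>S m \<omega>\<bar> < \<epsilon> m" using \<omega> by (auto simp: D_def)
        have "4 * sqrt (real m * ln (real m)) \<le> \<bar>Z s \<omega> + S m \<omega>\<bar>"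
          using m by (simp add: discard_test_def typed_rewards_def S_def)
        then have "sqrt (real m * ln (real m)) \<le> \<bar>Z s \<omega>\<bar>" using S by (simp add: \<epsilon>_def)
        then have "(sqrt (real m * ln (real m)))\<^sup>2 \<le> \<bar>Z s \<omega>\<bar>\<^sup>2" using m3 by (intro power_mono) auto
        then have "real m * ln (real m) \<le> (Z s \<omega>)\<^sup>2" using m3 by simp
        moreover have "exp 1 \<le> real m" using exp_le m3 by linarith
        then have "1 \<le> ln (real m)" using m3 by (subst ln_ge_iff) auto
        then have "real m \<le> real m * ln (real m)" using mult_left_mono[of 1 "ln (real m)" "real m"] by simp
        ultimately have "m \<le> q" unfolding q_def by (intro le_nat_floor) linarith
        then show ?thesis using m3 by auto
      qed
    qed
    then have "survival_count (typed_rewards k k s \<omega>) (Z s \<omega>) s n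
      \<le> card ({1, 2} \<union> {1..q} \<union> {m \<in> {2..n}. \<omega> \<in> D m})"
      unfolding survival_count_def by (intro card_mono) auto
    also have "\<dots> \<le> card {1, 2::nat} + card {1..q} + card {m \<in> {2..n}. \<omega> \<in> D m}"
      by (intro order_trans[OF card_Un_le] add_mono card_Un_le order_refl)
    finally have "survival_count (typed_rewards k k s \<omega>) (Z s \<omega>) s n \<le> 2 + q + card {m \<in> {2..n}. \<omega> \<in> D m}"
      by simp
    then have "real (survival_count (typed_rewards k k s \<omega>) (Z s \<omega>) s n) \<le> 2 + real q + real (card {m \<in> {2..n}. \<omega> \<in> D m})"
      by linarith
    moreover have "real q \<le> (Z s \<omega>)\<^sup>2" by (simp add: q_def)
    moreover have "real (card {m \<in> {2..n}. \<omega> \<in> D m}) = (\<Sum>m=2..n. indicator (D m) \<omega>)"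
      by (simp add: indicator_def sum.If_cases Int_def)
    ultimately show ?thesis by linarith
  qed
  have int: "integrable M (\<lambda>\<omega>. 2 + (Z s \<omega>)\<^sup>2 + (\<Sum>m=2..n. indicator (D m) \<omega>))"
    using Z_squared[OF s] D by (simp add: emeasure_eq_measure)
  have "expectation (\<lambda>\<omega>. real (survival_count (typed_rewards k k s \<omega>) (Z s \<omega>) s n))
      \<le> expectation (\<lambda>\<omega>. 2 + (Z s \<omega>)\<^sup>2 + (\<Sum>m=2..n. indicator (D m) \<omega>))"
    using int bound by (intro integral_mono') (auto intro!: add_nonneg_nonneg sum_nonneg)
  also have "\<dots> = 3 + (\<Sum>m=2..n. prob (D m))"
    using Z_squared[OF s] D by (simp add: emeasure_eq_measure prob_space)
  also have "\<dots> \<le> 3 + (\<Sum>m=2..n. 2 * (1 / (real m)\<^sup>2))" using PD by (intro add_left_mono sum_mono) auto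
  also have "\<dots> \<le> 5" using sum_inverse_squares_le[of n] by (simp only: sum_distrib_left[symmetric])
  finally show ?thesis .
qed

section \<open>Survival of mixed pairs\<close>

definition persists :: "nat \<Rightarrow> nat \<Rightarrow> nat \<Rightarrow> 'a set" where
  "persists k l s = {\<omega> \<in> space M. \<forall>m\<ge>1. \<not> discard_test (typed_rewards k l s \<omega>) (Z s \<omega>) s m}"

lemma discard_test_measurable:
  assumes "k \<in> {1, 2}" "l \<in> {1, 2}"
  shows "Measurable.pred (generated (future s)) (\<lambda>\<omega>. discard_test (typed_rewards k l s \<omega>) (Z s \<omega>) s m)"
proof (rule measurable_discard_test[OF _ Z_generated])
  fix i j :: nat assume ij: "i \<in> {s, Suc s}" "1 \<le> j"
  have "Y k i j \<in> borel_measurable (generated (future s))" "Y l i j \<in> borel_measurable (generated (future s))"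
    by (rule reward_generated; use ij assms in \<open>force simp: future_def\<close>)+
  then show "(\<lambda>\<omega>. typed_rewards k l s \<omega> i j) \<in> borel_measurable (generated (future s))"
    by (cases "i = s") (simp_all add: typed_rewards_def)
qed

lemma persists_generated:
  assumes "k \<in> {1, 2}" "l \<in> {1, 2}"
  shows "persists k l s \<in> sets (generated (future s))"
proof -
  note [measurable] = discard_test_measurable[OF assms]
  have "{\<omega> \<in> space (generated (future s)). \<forall>m\<ge>1. \<not> discard_test (typed_rewards k l s \<omega>) (Z s \<omega>) s m} \<in> sets (generated (future s))"
    by measurable
  then show ?thesis unfolding persists_def space_generated .
qed

lemma gap_bounds: "0 < \<mu> 1 - \<mu> 2" "\<mu> 1 - \<mu> 2 \<le> 1"
  using gap mean_in_unit[of 1] mean_in_unit[of 2] by auto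

lemma T0_ge: "3 \<le> T0 (\<mu> 1 - \<mu> 2)"
  using linear_ge_sqrt_log(2)[OF gap_bounds, of "nat (T0 (\<mu> 1 - \<mu> 2))"] of_nat_ceiling by simp

text \<open>The sign \<open>c\<close> of the drift treats both orders of a mixed pair at once. The
  Gaussian event \<open>A\<close> and the reward event \<open>C\<close> use disjoint sources; they
  supply the tail and the factor \<open>1 / 2\<close> of \<open>beta\<close>.\<close>

lemma prob_persists:
  assumes kl: "{k, l} = {1, 2}" and s: "1 \<le> s"
  shows "beta (\<mu> 1 - \<mu> 2) \<le> prob (persists k l s)"
proof -
  define \<Delta> N c where "\<Delta> = \<mu> 1 - \<mu> 2" and "N = nat (T0 \<Delta>)" and "c = (if k = 1 then 1 else - 1 :: real)"
  have k: "k \<in> {1, 2}" "l \<in> {1, 2}" and c: "c \<in> {1, -1}" using kl by (auto simp: c_def)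
  have \<mu>: "c * (\<mu> k - \<mu> l) = \<Delta>" using kl by (auto simp: c_def \<Delta>_def doubleton_eq_iff)
  have \<Delta>: "0 < \<Delta>" "\<Delta> \<le> 1" using gap_bounds by (auto simp: \<Delta>_def)
  have N: "3 \<le> N" "real N = real_of_int (T0 \<Delta>)" using T0_ge by (auto simp: N_def \<Delta>_def)
  define S where "S = (\<lambda>m \<omega>. \<Sum>j=1..m. Y k s j \<omega> - Y l (Suc s) j \<omega>)"
  define J where "J = future s - {Gauss s}"
  define B where "B m = {\<omega> \<in> space M. c * S m \<omega> < 4 * sqrt (real m * ln (real m))}" for m
  define A where "A = {\<omega> \<in> space M. bound_f (real N) \<le> c * Z s \<omega>}"
  have Jsub: "J \<subseteq> sources" using future_subset[OF s] by (auto simp: J_def)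
  have [measurable]: "S m \<in> borel_measurable (generated J)" for m
    using differences_measurable[OF k] by (simp add: S_def J_def)
  have B: "B m \<in> sets (generated J)" for m
  proof -
    have "{\<omega> \<in> space (generated J). c * S m \<omega> < 4 * sqrt (real m * ln (real m))} \<in> sets (generated J)" by measurable
    then show ?thesis by (simp add: B_def)
  qed
  have BM: "B m \<in> events" for m using generated_events[OF Jsub B] .
  have PB: "prob (B m) \<le> 1 / (real m)\<^sup>2" if m: "N \<le> m" for m
  proof -
    let ?e = "4 * sqrt (real m * ln (real m))"
    have m0: "1 \<le> m" using m N by simp
    \<comment> \<open>The drift is at least twice the threshold, so \<open>B m\<close> requires a
      fluctuation as large as the threshold itself.\<close>
    have "8 * sqrt (real m * ln (real m)) \<le> real m * \<Delta>"
      using m N by (intro linear_ge_sqrt_log(1)[OF \<Delta>]) simp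
    moreover have "- c * (S m \<omega> - real m * (\<mu> k - \<mu> l)) = real m * \<Delta> - c * S m \<omega>" for \<omega>
      unfolding \<mu>[symmetric] by (simp add: algebra_simps)
    ultimately have "B m \<subseteq> {\<omega> \<in> space M. - c * (S m \<omega> - real m * (\<mu> k - \<mu> l)) \<ge> ?e}"
      by (auto simp: B_def)
    moreover have "(\<lambda>\<omega>. - c * (S m \<omega> - real m * (\<mu> k - \<mu> l))) \<in> borel_measurable M"
      using generated_measurable[OF Jsub, of "S m"] by simp
    then have "{\<omega> \<in> space M. - c * (S m \<omega> - real m * (\<mu> k - \<mu> l)) \<ge> ?e} \<in> events"
      by simp
    ultimately have "prob (B m) \<le> prob {\<omega> \<in> space M. - c * (S m \<omega> - real m * (\<mu> k - \<mu> l)) \<ge> ?e}"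
      by (rule finite_measure_mono)
    also have "\<dots> \<le> exp (- ?e\<^sup>2 / real m)"
      unfolding S_def using m0 c by (intro difference_tail[OF k s]) auto
    also have "- ?e\<^sup>2 / real m = - (16 * ln (real m))"
      using m0 by (simp add: power_mult_distrib)
    also have "exp \<dots> \<le> 1 / (real m)\<^sup>2" using m0 by (intro exp_ln_le_inverse_power) auto
    finally show ?thesis .
  qed
  define C where "C = (\<Inter>i. space M - B (N + i))"
  have C: "C \<in> sets (generated J)"
    unfolding C_def using sets.compl_sets[OF B] by (intro sets.countable_INT) auto
  have "prob (\<Union>i. B (N + i)) \<le> 1 / 2"
  proof -
    \<comment> \<open>Dominating \<open>1 / m^2\<close> by \<open>1 / (m - 1) - 1 / m\<close> bounds
      the tail from \<open>N\<close> on by \<open>1 / (N - 1)\<close>, which is at most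
      \<open>1 / 2\<close> because \<open>N\<close> is at least 3.\<close>
    define g where "g = (\<lambda>i. 1 / real (i + (N - 1)))"
    have "g \<longlonglongrightarrow> 0"
      unfolding g_def by (rule LIMSEQ_ignore_initial_segment[OF lim_1_over_n])
    have sums: "(\<lambda>i. g i - g (Suc i)) sums (g 0 - 0)"
      by (rule telescope_sums') fact
    have le: "prob (B (N + i)) \<le> g i - g (Suc i)" for i
    proof -
      have "prob (B (N + i)) \<le> 1 / (real (N + i))\<^sup>2" by (rule PB) simp
      also have "\<dots> \<le> 1 / (real (N + i - 1) * real (N + i))"
        using N(1) by (intro divide_left_mono) (auto simp: power2_eq_square)
      also have "\<dots> = 1 / real (N + i - 1) - 1 / real (N + i)"
        using N(1) by (simp add: field_simps of_nat_diff)
      also have "\<dots> = g i - g (Suc i)"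
        using N(1) by (simp add: g_def add.commute)
      finally show ?thesis .
    qed
    have summable: "summable (\<lambda>i. prob (B (N + i)))"
      by (rule summable_comparison_test'[OF sums_summable[OF sums], of 0]) (use le in auto)
    have "prob (\<Union>i. B (N + i)) \<le> (\<Sum>i. prob (B (N + i)))"
      using BM summable by (intro finite_measure_subadditive_countably) auto
    also have "\<dots> \<le> g 0"
      using suminf_le[OF le summable sums_summable[OF sums]] sums_unique[OF sums] by simp
    also have "\<dots> \<le> 1 / 2" using N by (simp add: g_def)
    finally show ?thesis .
  qed
  moreover have "C = space M - (\<Union>i. B (N + i))" by (auto simp: C_def)
  ultimately have PC: "1 / 2 \<le> prob C"
    using prob_compl[of "\<Union>i. B (N + i)"] BM by auto
  have A: "A \<in> sets (generated {Gauss s})"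
  proof -
    have [measurable]: "Z s \<in> borel_measurable (generated {Gauss s})"
      using X_measurable_generated[of "Gauss s" "{Gauss s}"] by simp
    have "{\<omega> \<in> space (generated {Gauss s}). bound_f (real N) \<le> c * Z s \<omega>} \<in> sets (generated {Gauss s})"
      by measurable
    then show ?thesis by (simp add: A_def)
  qed
  have PA: "prob A = Phi_bar (bound_f (real N))"
    unfolding A_def by (rule gauss_tail[OF s c])
  have "beta \<Delta> = prob A * (1 / 2)"
    by (simp add: beta_def PA N)
  also have "\<dots> \<le> prob A * prob C" using PC by (intro mult_left_mono) auto
  also have "\<dots> = prob (A \<inter> C)"
    using s Jsub A C by (intro prob_Int_generated[symmetric, where J = "{Gauss s}" and K = J])
      (auto simp: sources_def J_def)
  also have "\<dots> \<le> prob (persists k l s)"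
  proof (rule finite_measure_mono)
    show "persists k l s \<in> events" using generated_events[OF future_subset[OF s] persists_generated[OF k]] .
    show "A \<inter> C \<subseteq> persists k l s"
    proof
      fix \<omega> assume \<omega>: "\<omega> \<in> A \<inter> C"
      then have sp: "\<omega> \<in> space M" by (simp add: A_def)
      have "\<not> discard_test (typed_rewards k l s \<omega>) (Z s \<omega>) s m" if "1 \<le> m" for m
      proof (rule not_discarded_if_drift[OF _ _ _ _ _ that])
        show "typed_rewards k l s \<omega> i j \<in> {0..1}" if "i \<in> {s, Suc s}" "1 \<le> j" for i j
          using reward_range[OF k(1) _ that(2) sp, of i] reward_range[OF k(2) _ that(2) sp, of i] that s
          by (auto simp: typed_rewards_def)
        show "c = 1 \<or> c = - 1" using c by simp
        show "bound_f (real N) \<le> c * Z s \<omega>" using \<omega> by (simp add: A_def)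
        show "1 \<le> N" using N by simp
        fix m assume "N \<le> m"
        then obtain i where "m = N + i" using le_Suc_ex by blast
        then have "\<omega> \<notin> B m" using \<omega> by (auto simp: C_def)
        then show "4 * sqrt (real m * ln (real m))
            \<le> c * (\<Sum>j=1..m. typed_rewards k l s \<omega> s j - typed_rewards k l s \<omega> (Suc s) j)"
          using sp by (simp add: B_def S_def typed_rewards_def)
      qed
      then show "\<omega> \<in> persists k l s" using sp by (simp add: persists_def)
    qed
  qed
  finally show ?thesis by (simp add: \<Delta>_def)
qed

end

section \<open>Counting epochs\<close>

lemma deviation_count_eq: "real (deviation_count r m n) = (\<Sum>T=2..n. if deviates r m T then 1 else 0)"
  by (simp add: deviation_count_def sum.If_cases Int_def)

lemma survival_count_eq: "real (survival_count x \<zeta> s n) = (\<Sum>m=1..n. if discard_test x \<zeta> s m then 0 else 1)"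
proof -
  have "(\<Sum>m=1..n. if discard_test x \<zeta> s m then 0 else (1::real)) = (\<Sum>m=1..n. if \<not> discard_test x \<zeta> s m then 1 else 0)"
    by (intro sum.cong) auto
  then show ?thesis by (simp add: survival_count_def sum.If_cases Int_def)
qed

lemma deviation_count_le: "deviation_count r m n \<le> n"
  unfolding deviation_count_def by (rule order_trans[OF card_mono[of "{1..n}"]]) auto

lemma survival_count_le: "survival_count x \<zeta> s n \<le> n"
  unfolding survival_count_def by (rule order_trans[OF card_mono[of "{1..n}"]]) auto

context alg2_bandit
begin

lemma beta_pos: "0 < beta (\<mu> 1 - \<mu> 2)"
proof -
  have "0 \<le> bound_f (real_of_int (T0 (\<mu> 1 - \<mu> 2)))"
    using T0_ge by (simp add: bound_f_def)
  from Phi_bar_pos[OF this] show ?thesis by (simp add: beta_def)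
qed

lemma reservoir_antimono: "1 \<le> s \<Longrightarrow> s \<le> t \<Longrightarrow> \<alpha> t \<le> \<alpha> s"
proof (induction t)
  case (Suc t)
  then show ?case using reservoir_decreasing[of t] by (cases "s = Suc t") auto
qed simp

lemma reservoir_bounds: "1 \<le> t \<Longrightarrow> 0 \<le> \<alpha> t \<and> \<alpha> t \<le> 1"
  using arm_type_prob[of t] by (metis measure_nonneg prob_le_1)

definition type_prob :: "nat \<Rightarrow> nat \<Rightarrow> real" where
  "type_prob k i = (if k = 1 then \<alpha> i else 1 - \<alpha> i)"

lemma type_event: "1 \<le> i \<Longrightarrow> {\<omega> \<in> space M. \<kappa> i \<omega> = k} \<in> events"
  using generated_events[OF order_refl type_generated[of i sources k]] by (auto simp: sources_def)

lemma prob_type: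
  assumes "1 \<le> i" "k \<in> {1, 2}"
  shows "prob {\<omega> \<in> space M. \<kappa> i \<omega> = k} = type_prob k i"
proof (cases "k = 1")
  case True
  then show ?thesis using arm_type_prob[OF assms(1)] by (simp add: type_prob_def)
next
  case False
  then have "{\<omega> \<in> space M. \<kappa> i \<omega> = k} = space M - {\<omega> \<in> space M. \<kappa> i \<omega> = 1}"
    using arm_types[OF assms(1)] assms(2) by fastforce
  then show ?thesis
    using prob_compl[OF type_event[OF assms(1), of 1]] arm_type_prob[OF assms(1)] False by (simp add: type_prob_def)
qed

section \<open>Starts of epochs and types of their arms\<close>

definition types :: "nat \<Rightarrow> nat \<Rightarrow> nat \<Rightarrow> 'a set" where
  "types k l s = {\<omega> \<in> space M. \<kappa> s \<omega> = k \<and> \<kappa> (Suc s) \<omega> = l}"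

text \<open>Whether an epoch starts at \<open>s\<close> is decided before the types of its arms are
  drawn. The second arm is queried one time unit later, hence its factor is taken at
  \<open>Suc s\<close>.\<close>

lemma starts_types:
  assumes s: "1 \<le> s" and kl: "k \<in> {1, 2}" "l \<in> {1, 2}"
  shows "starts s \<inter> types k l s \<in> sets (generated (past s \<union> {Type_of s, Type_of (Suc s)}))"
    and "prob (starts s \<inter> types k l s) = prob (starts s) * (type_prob k s * type_prob l (Suc s))"
proof -
  let ?J = "past s \<union> {Type_of s, Type_of (Suc s)}"
  have types: "types k l s = {\<omega> \<in> space M. \<kappa> s \<omega> = k} \<inter> {\<omega> \<in> space M. \<kappa> (Suc s) \<omega> = l}"
    by (auto simp: types_def)
  have T: "types k l s \<in> sets (generated J)" if "{Type_of s, Type_of (Suc s)} \<subseteq> J" for J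
    unfolding types using that by (intro sets.Int type_generated) auto
  have "starts s \<in> sets (generated ?J)"
    using starts_generated[OF s] generated_mono[of "past s" ?J] by auto
  then show "starts s \<inter> types k l s \<in> sets (generated ?J)" using T by auto
  have "prob (starts s \<inter> types k l s) = prob (starts s) * prob (types k l s)"
    using past_subset s T starts_generated[OF s]
    by (intro prob_Int_generated[where J = "past s" and K = "{Type_of s, Type_of (Suc s)}"]) (auto simp: sources_def past_def)
  also have "prob (types k l s) = prob {\<omega> \<in> space M. \<kappa> s \<omega> = k} * prob {\<omega> \<in> space M. \<kappa> (Suc s) \<omega> = l}"
    unfolding types using s
    by (intro prob_Int_generated[where J = "{Type_of s}" and K = "{Type_of (Suc s)}"] type_generated) (auto simp: sources_def)
  also have "\<dots> = type_prob k s * type_prob l (Suc s)" using s kl by (simp add: prob_type)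
  finally show "prob (starts s \<inter> types k l s) = prob (starts s) * (type_prob k s * type_prob l (Suc s))" .
qed

lemma present_sources:
  assumes "1 \<le> s"
  shows "past s \<union> {Type_of s, Type_of (Suc s)} \<subseteq> sources" "(past s \<union> {Type_of s, Type_of (Suc s)}) \<inter> future s = {}"
  using assms past_subset by (auto simp: sources_def past_def future_def)

lemma discard_test_types:
  "\<omega> \<in> types k l s \<Longrightarrow> discard_test (rewards \<kappa> Y \<omega>) \<zeta> s m = discard_test (typed_rewards k l s \<omega>) \<zeta> s m"
  by (simp add: discard_test_def types_def rewards_def typed_rewards_def)

text \<open>At most one epoch persists, so the persistence events are disjoint.\<close>

lemma sum_mixed_epochs:
  "(\<Sum>s=1..n. prob (starts s \<inter> types 1 2 s) + prob (starts s \<inter> types 2 1 s)) * beta (\<mu> 1 - \<mu> 2) \<le> 1"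
proof -
  define A where "A = (\<lambda>k l s. starts s \<inter> types k l s \<inter> persists k l s)"
  define F where "F = (\<lambda>s. A 1 2 s \<union> A 2 1 s)"
  have A: "A k l s \<in> events" "prob (starts s \<inter> types k l s) * beta (\<mu> 1 - \<mu> 2) \<le> prob (A k l s)"
    if kl: "{k, l} = {1, 2}" and s: "1 \<le> s" for k l s
  proof -
    have k: "k \<in> {1, 2}" "l \<in> {1, 2}" using kl by auto
    note st = starts_types(1)[OF s k] and pr = persists_generated[OF k, of s]
    show "A k l s \<in> events"
      unfolding A_def using generated_events[OF present_sources(1)[OF s] st] generated_events[OF future_subset[OF s] pr] by blast
    have "prob (A k l s) = prob (starts s \<inter> types k l s) * prob (persists k l s)"
      unfolding A_def by (rule prob_Int_generated[OF present_sources(1)[OF s] future_subset[OF s] present_sources(2)[OF s] st pr])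
    then show "prob (starts s \<inter> types k l s) * beta (\<mu> 1 - \<mu> 2) \<le> prob (A k l s)"
      using prob_persists[OF kl s] by (simp add: mult_left_mono)
  qed
  have F: "F s \<in> events" if "s \<in> {1..n}" for s
    using A(1)[of 1 2 s] A(1)[of 2 1 s] that by (auto simp: F_def insert_commute)
  have stay: "epoch \<omega> t = s" if "\<omega> \<in> A k l s" "1 \<le> s" "s \<le> t" for \<omega> k l s t
  proof -
    have "\<not> discard_test (rewards \<kappa> Y \<omega>) (Z s \<omega>) s m" if "1 \<le> m" for m
      using \<open>\<omega> \<in> A k l s\<close> that discard_test_types[of \<omega> k l s] by (simp add: A_def persists_def)
    moreover have "epoch \<omega> s = s" using that by (simp add: A_def starts_def)
    ultimately show ?thesis
      using epoch_forever[where z = "\<lambda>i. Z i \<omega>", of "rewards \<kappa> Y \<omega>" "\<lambda>t h. tie t h (U \<omega>)" s t] that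
      by (simp add: epoch_def run_def)
  qed
  have disj: "disjoint_family_on F {1..n}"
  proof -
    have "F s \<inter> F t = {}" if "s < t" "1 \<le> s" for s t
    proof -
      have "\<omega> \<notin> F t" if \<omega>: "\<omega> \<in> F s" for \<omega>
      proof -
        obtain k l where "\<omega> \<in> A k l s" using \<omega> unfolding F_def by blast
        from stay[OF this] have "epoch \<omega> t = s" using \<open>s < t\<close> \<open>1 \<le> s\<close> by simp
        then show ?thesis using \<open>s < t\<close> by (auto simp: F_def A_def starts_def)
      qed
      then show ?thesis by auto
    qed
    then show ?thesis unfolding disjoint_family_on_def by (metis Int_commute atLeastAtMost_iff linorder_neqE_nat)
  qed
  have PF: "(prob (starts s \<inter> types 1 2 s) + prob (starts s \<inter> types 2 1 s)) * beta (\<mu> 1 - \<mu> 2) \<le> prob (F s)"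
    if s: "s \<in> {1..n}" for s
  proof -
    have "prob (F s) = prob (A 1 2 s) + prob (A 2 1 s)"
      unfolding F_def using A(1)[of 1 2 s] A(1)[of 2 1 s] s
      by (intro finite_measure_Union) (auto simp: A_def types_def insert_commute)
    then show ?thesis
      using A(2)[of 1 2 s] A(2)[of 2 1 s] s by (simp add: insert_commute distrib_right)
  qed
  have "(\<Sum>s=1..n. prob (starts s \<inter> types 1 2 s) + prob (starts s \<inter> types 2 1 s)) * beta (\<mu> 1 - \<mu> 2) \<le> (\<Sum>s=1..n. prob (F s))"
    unfolding sum_distrib_right using PF by (rule sum_mono)
  also have "\<dots> = prob (\<Union>s\<in>{1..n}. F s)"
    using F disj by (intro finite_measure_finite_Union[symmetric]) auto
  also have "\<dots> \<le> 1" by (rule prob_le_1)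
  finally show ?thesis .
qed

text \<open>A bound on the inferior plays of an epoch whose arms have types \<open>k\<close> and
  \<open>l\<close>. It is made from \<open>future s\<close> only, so that its expectation factors
  from the probability that such an epoch starts. For equal types it bounds the whole length of the
  epoch.\<close>

definition cost :: "nat \<Rightarrow> nat \<Rightarrow> nat \<Rightarrow> nat \<Rightarrow> 'a \<Rightarrow> real" where
  "cost n k l s \<omega> =
     (let d1 = real (deviation_count (\<lambda>j. Y k s j \<omega>) (\<mu> k) n);
          d2 = real (deviation_count (\<lambda>j. Y l (Suc s) j \<omega>) (\<mu> l) n)
      in if k = l then 2 + 450 * real (survival_count (typed_rewards k l s \<omega>) (Z s \<omega>) s n) + 2 * d1 + 2 * d2
         else 1 + 8 * ln (real n) / (\<mu> 1 - \<mu> 2)\<^sup>2 + d1 + d2)"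

lemma deviation_count_measurable:
  assumes "k \<in> {1, 2}" "i \<in> {s, Suc s}"
  shows "(\<lambda>\<omega>. real (deviation_count (\<lambda>j. Y k i j \<omega>) m n)) \<in> borel_measurable (generated (future s))"
proof -
  have "Y k i j \<in> borel_measurable (generated (future s))" if "1 \<le> j" for j
    by (rule reward_generated) (use assms that in \<open>force simp: future_def\<close>)
  then have [measurable]: "Measurable.pred (generated (future s)) (\<lambda>\<omega>. deviates (\<lambda>j. Y k i j \<omega>) m T)" for T
    by (rule measurable_deviates)
  show ?thesis unfolding deviation_count_eq by measurable
qed

lemma survival_count_measurable:
  assumes "k \<in> {1, 2}" "l \<in> {1, 2}"
  shows "(\<lambda>\<omega>. real (survival_count (typed_rewards k l s \<omega>) (Z s \<omega>) s n)) \<in> borel_measurable (generated (future s))"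
proof -
  note [measurable] = discard_test_measurable[OF assms]
  show ?thesis unfolding survival_count_eq by measurable
qed

text \<open>Deviation counts have mean at most 2 and survival counts at most 5, so the constants are
  \<open>2 + 450 * 5 + 2 * 2 + 2 * 2 = 2260\<close> and \<open>1 + 2 + 2 = 5\<close>.\<close>

lemma cost:
  assumes s: "1 \<le> s" and kl: "k \<in> {1, 2}" "l \<in> {1, 2}"
  shows "cost n k l s \<in> borel_measurable (generated (future s))" and "integrable M (cost n k l s)"
    and "expectation (cost n k l s) \<le> (if k = l then 2260 else 8 * ln (real n) / (\<mu> 1 - \<mu> 2)\<^sup>2 + 5)"
proof -
  note m1 = deviation_count_measurable[OF kl(1), of s s "\<mu> k" n, simplified]
    and m2 = deviation_count_measurable[OF kl(2), of "Suc s" s "\<mu> l" n, simplified]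
    and m3 = survival_count_measurable[OF kl, of s n]
  show "cost n k l s \<in> borel_measurable (generated (future s))"
    unfolding cost_def[abs_def] Let_def using m1 m2 m3 by (cases "k = l") auto
  note M = generated_measurable[OF future_subset[OF s]]
  have i1: "integrable M (\<lambda>\<omega>. real (deviation_count (\<lambda>j. Y k s j \<omega>) (\<mu> k) n))"
    using M[OF m1] deviation_count_le by (intro integrable_const_bound[where B = n]) auto
  have i2: "integrable M (\<lambda>\<omega>. real (deviation_count (\<lambda>j. Y l (Suc s) j \<omega>) (\<mu> l) n))"
    using M[OF m2] deviation_count_le by (intro integrable_const_bound[where B = n]) auto
  have i3: "integrable M (\<lambda>\<omega>. real (survival_count (typed_rewards k l s \<omega>) (Z s \<omega>) s n))"
    using M[OF m3] survival_count_le by (intro integrable_const_bound[where B = n]) auto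
  show "integrable M (cost n k l s)"
    unfolding cost_def[abs_def] Let_def using i1 i2 i3 by (cases "k = l") auto
  note e = expectation_deviation_count[OF kl(1) s, of n] expectation_deviation_count[OF kl(2), of "Suc s" n]
  show "expectation (cost n k l s) \<le> (if k = l then 2260 else 8 * ln (real n) / (\<mu> 1 - \<mu> 2)\<^sup>2 + 5)"
  proof (cases "k = l")
    case True
    then have "expectation (cost n k l s) = 2 + 450 * expectation (\<lambda>\<omega>. real (survival_count (typed_rewards k l s \<omega>) (Z s \<omega>) s n))
       + 2 * expectation (\<lambda>\<omega>. real (deviation_count (\<lambda>j. Y k s j \<omega>) (\<mu> k) n))
       + 2 * expectation (\<lambda>\<omega>. real (deviation_count (\<lambda>j. Y l (Suc s) j \<omega>) (\<mu> l) n))"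
      unfolding cost_def[abs_def] Let_def using i1 i2 i3 by (simp add: prob_space)
    then show ?thesis using e expectation_survival_count[OF kl(1) s, of n] True by simp
  next
    case False
    then have "expectation (cost n k l s) = 1 + 8 * ln (real n) / (\<mu> 1 - \<mu> 2)\<^sup>2
       + expectation (\<lambda>\<omega>. real (deviation_count (\<lambda>j. Y k s j \<omega>) (\<mu> k) n))
       + expectation (\<lambda>\<omega>. real (deviation_count (\<lambda>j. Y l (Suc s) j \<omega>) (\<mu> l) n))"
      unfolding cost_def[abs_def] Let_def using i1 i2 by (simp add: prob_space)
    then show ?thesis using e False by simp
  qed
qed

lemma cost_nonneg: "1 \<le> n \<Longrightarrow> 0 \<le> cost n k l s \<omega>"
  by (simp add: cost_def Let_def)

lemma epoch_bounds: "1 \<le> t \<Longrightarrow> 1 \<le> epoch \<omega> t \<and> epoch \<omega> t \<le> t"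
  unfolding epoch_def run_def using ep_bounds by blast

lemma play_cases: "1 \<le> t \<Longrightarrow> play \<omega> t \<in> {epoch \<omega> t, Suc (epoch \<omega> t)}"
  unfolding epoch_def run_def play_def using arm_cases by blast

lemma starts_if_epoch:
  assumes "epoch \<omega> t = s" "1 \<le> t" "\<omega> \<in> space M"
  shows "\<omega> \<in> starts s"
  using ep_const[of "rewards \<kappa> Y \<omega>" "\<lambda>i. Z i \<omega>" "\<lambda>t h. tie t h (U \<omega>)" t s s] epoch_bounds[OF assms(2), of \<omega>] assms
  by (simp add: starts_def epoch_def run_def)

text \<open>If an inferior play occurs, the epoch has started and its arms are not both optimal, so
  exactly one of the three indicators equals 1. For a mixed pair the inferior plays are the pulls of
  one known arm; for two inferior arms they are all plays of the epoch.\<close>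

lemma inferior_plays_in_epoch:
  assumes \<omega>: "\<omega> \<in> space M" and s: "1 \<le> s" and n: "1 \<le> n"
  shows "(\<Sum>t=1..n. if epoch \<omega> t = s \<and> \<kappa> (play \<omega> t) \<omega> = 2 then 1 else 0)
    \<le> indicator (starts s \<inter> types 1 2 s) \<omega> * cost n 1 2 s \<omega>
      + indicator (starts s \<inter> types 2 1 s) \<omega> * cost n 2 1 s \<omega>
      + indicator (starts s \<inter> types 2 2 s) \<omega> * cost n 2 2 s \<omega>"
proof -
  define W where "W = {t \<in> {1..n}. epoch \<omega> t = s \<and> \<kappa> (play \<omega> t) \<omega> = 2}"
  have sum: "(\<Sum>t=1..n. if epoch \<omega> t = s \<and> \<kappa> (play \<omega> t) \<omega> = 2 then 1 else 0) = real (card W)"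
    by (simp add: W_def sum.If_cases Int_def)
  define k l where "k = \<kappa> s \<omega>" and "l = \<kappa> (Suc s) \<omega>"
  have kl: "k \<in> {1, 2}" "l \<in> {1, 2}" using arm_types[OF s \<omega>] arm_types[of "Suc s", OF _ \<omega>] by (auto simp: k_def l_def)
  have types: "\<omega> \<in> types k' l' s \<longleftrightarrow> k = k' \<and> l = l'" for k' l' using \<omega> by (auto simp: types_def k_def l_def)
  have x: "rewards \<kappa> Y \<omega> s = (\<lambda>j. Y k s j \<omega>)" "rewards \<kappa> Y \<omega> (Suc s) = (\<lambda>j. Y l (Suc s) j \<omega>)"
    by (auto simp: rewards_def k_def l_def)
  have surv: "survival_count (rewards \<kappa> Y \<omega>) (Z s \<omega>) s n = survival_count (typed_rewards k l s \<omega>) (Z s \<omega>) s n"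
    using discard_test_types[of \<omega> k l s] types by (simp add: survival_count_def)
  let ?ep = "ep (rewards \<kappa> Y \<omega>) (\<lambda>i. Z i \<omega>) (\<lambda>t h. tie t h (U \<omega>))"
  let ?arm = "arm (rewards \<kappa> Y \<omega>) (\<lambda>i. Z i \<omega>) (\<lambda>t h. tie t h (U \<omega>))"
  have W_eq: "W = {t \<in> {1..n}. ?ep t = s \<and> \<kappa> (?arm t) \<omega> = 2}"
    by (simp add: W_def epoch_def run_def play_def)
  have arm: "t \<in> W \<Longrightarrow> ?arm t = s \<or> ?arm t = Suc s" for t
    using play_cases[of t \<omega>] by (auto simp: W_def play_def)
  consider "W = {}" | "W \<noteq> {}" "k = 1" "l = 2" | "W \<noteq> {}" "k = 2" "l = 1" | "W \<noteq> {}" "k = 2" "l = 2"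
  proof -
    have "W = {}" if "k = 1" "l = 1" using that arm by (fastforce simp: W_eq k_def l_def)
    then show thesis using that kl by auto
  qed
  then have "real (card W) \<le> (if W = {} then 0 else cost n k l s \<omega>) \<and> (W \<noteq> {} \<longrightarrow> (k, l) \<in> {(1, 2), (2, 1), (2, 2)})"
  proof cases
    case 2
    then have "W \<subseteq> {t \<in> {1..n}. ?ep t = s \<and> ?arm t = Suc s}"
      using arm by (fastforce simp: W_eq k_def l_def)
    then have "real (card W) \<le> real (card {t \<in> {1..n}. ?ep t = s \<and> ?arm t = Suc s})"
      by (simp add: card_mono)
    also have "\<dots> \<le> 1 + 8 * ln (real n) / (\<mu> 1 - \<mu> 2)\<^sup>2
        + real (deviation_count (rewards \<kappa> Y \<omega> s) (\<mu> 1) n) + real (deviation_count (rewards \<kappa> Y \<omega> (Suc s)) (\<mu> 2) n)"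
      by (rule card_inferior_plays[OF s _ gap n]) simp
    finally show ?thesis using 2 by (simp add: cost_def x)
  next
    case 3
    then have "W \<subseteq> {t \<in> {1..n}. ?ep t = s \<and> ?arm t = s}"
      using arm by (fastforce simp: W_eq k_def l_def)
    then have "real (card W) \<le> real (card {t \<in> {1..n}. ?ep t = s \<and> ?arm t = s})"
      by (simp add: card_mono)
    also have "\<dots> \<le> 1 + 8 * ln (real n) / (\<mu> 1 - \<mu> 2)\<^sup>2
        + real (deviation_count (rewards \<kappa> Y \<omega> (Suc s)) (\<mu> 1) n) + real (deviation_count (rewards \<kappa> Y \<omega> s) (\<mu> 2) n)"
      by (rule card_inferior_plays[OF s _ gap n]) auto
    finally show ?thesis using 3 by (simp add: cost_def x)
  next
    case 4
    have "real (card W) \<le> real (card {t \<in> {1..n}. ?ep t = s})"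
      by (simp add: card_mono W_eq subset_iff)
    also have "\<dots> \<le> 2 + 450 * real (survival_count (rewards \<kappa> Y \<omega>) (Z s \<omega>) s n)
      + 2 * real (deviation_count (rewards \<kappa> Y \<omega> s) (\<mu> 2) n) + 2 * real (deviation_count (rewards \<kappa> Y \<omega> (Suc s)) (\<mu> 2) n)"
      by (rule card_epoch_length[OF s, where z = "\<lambda>i. Z i \<omega>"])
    finally show ?thesis using 4 by (simp add: cost_def x surv)
  qed simp
  moreover have "\<omega> \<in> starts s" if "W \<noteq> {}"
    using that starts_if_epoch[OF _ _ \<omega>] by (auto simp: W_def)
  moreover have "0 \<le> cost n k' l' s \<omega>" for k' l'
    by (rule cost_nonneg[OF n])
  ultimately show ?thesis
    unfolding sum by (cases "W = {}") (auto simp: types)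
qed

text \<open>The epoch that starts at \<open>n\<close> contains at most the play at time
  \<open>n\<close>, which gives the 1. Leaving it out of the sum keeps both arms of every remaining
  epoch within the times up to \<open>n\<close>, where the reservoir probability is at least
  \<open>\<alpha> n\<close>.\<close>

lemma inferior_plays:
  assumes \<omega>: "\<omega> \<in> space M" and n: "1 \<le> n"
  shows "(\<Sum>t=1..n. of_bool (\<kappa> (play \<omega> t) \<omega> = 2))
    \<le> 1 + (\<Sum>s=1..<n. indicator (starts s \<inter> types 1 2 s) \<omega> * cost n 1 2 s \<omega>
      + indicator (starts s \<inter> types 2 1 s) \<omega> * cost n 2 1 s \<omega>
      + indicator (starts s \<inter> types 2 2 s) \<omega> * cost n 2 2 s \<omega>)"
proof -
  let ?c = "\<lambda>s t. if epoch \<omega> t = s \<and> \<kappa> (play \<omega> t) \<omega> = 2 then 1 else 0 :: real"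
  have "(\<Sum>t=1..n. of_bool (\<kappa> (play \<omega> t) \<omega> = 2)) = (\<Sum>t=1..n. \<Sum>s=1..n. ?c s t)"
  proof (rule sum.cong[OF refl])
    fix t assume "t \<in> {1..n}"
    then have "epoch \<omega> t \<in> {1..n}" using epoch_bounds[of t \<omega>] by auto
    then show "of_bool (\<kappa> (play \<omega> t) \<omega> = 2) = (\<Sum>s=1..n. ?c s t)"
      by (cases "\<kappa> (play \<omega> t) \<omega> = 2") auto
  qed
  also have "\<dots> = (\<Sum>s=1..n. \<Sum>t=1..n. ?c s t)" by (rule sum.swap)
  also have "\<dots> = (\<Sum>t=1..n. ?c n t) + (\<Sum>s=1..<n. \<Sum>t=1..n. ?c s t)"
    using n by (subst sum.last_plus) auto
  also have "(\<Sum>t=1..n. ?c n t) \<le> (\<Sum>t=1..n. if t = n then 1 else 0)"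
  proof (rule sum_mono)
    fix t assume "t \<in> {1..n}"
    then show "?c n t \<le> (if t = n then 1 else 0)" using epoch_bounds[of t \<omega>] by auto
  qed
  also have "\<dots> \<le> 1" by simp
  finally show ?thesis
    using sum_mono[OF inferior_plays_in_epoch[OF \<omega> _ n], of "{1..<n}" "\<lambda>s. s"] by simp
qed

text \<open>Each of the two mixed orders alone dominates the left side: one factor
  \<open>1 - \<alpha>\<close> is bounded by 1, and \<open>\<alpha> n\<close> by the probability of
  type 1 at that arm. Averaging both orders gives the half.\<close>

lemma reservoir_ratio:
  assumes "1 \<le> s" "s < n"
  shows "\<alpha> n * (type_prob 2 s * type_prob 2 (Suc s))
    \<le> (type_prob 1 s * type_prob 2 (Suc s) + type_prob 2 s * type_prob 1 (Suc s)) / 2"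
proof -
  have a: "\<alpha> n \<le> \<alpha> s" "\<alpha> n \<le> \<alpha> (Suc s)" "0 \<le> \<alpha> n" "0 \<le> 1 - \<alpha> s" "1 - \<alpha> s \<le> 1" "0 \<le> 1 - \<alpha> (Suc s)" "1 - \<alpha> (Suc s) \<le> 1"
    using reservoir_antimono[of s n] reservoir_antimono[of "Suc s" n] reservoir_bounds[of n] reservoir_bounds[of s]
      reservoir_bounds[of "Suc s"] assms by auto
  have "\<alpha> n * ((1 - \<alpha> s) * (1 - \<alpha> (Suc s))) \<le> \<alpha> s * (1 * (1 - \<alpha> (Suc s)))"
    using a by (intro mult_mono mult_nonneg_nonneg) auto
  moreover have "\<alpha> n * ((1 - \<alpha> s) * (1 - \<alpha> (Suc s))) \<le> \<alpha> (Suc s) * ((1 - \<alpha> s) * 1)"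
    using a by (intro mult_mono mult_nonneg_nonneg) auto
  ultimately show ?thesis by (simp add: type_prob_def algebra_simps)
qed

section \<open>Assembly of the regret bound\<close>

lemma regret_bound:
  assumes n: "1 \<le> n"
  defines "\<Delta> \<equiv> \<mu> 1 - \<mu> 2"
  shows "\<alpha> n * expectation (alg2_regret \<mu> \<kappa> Y Z U tie n)
    \<le> 8 / (\<Delta> * beta \<Delta>) * ln (real n) + \<Delta> * (1 + 1135 / beta \<Delta>)"
proof -
  define P where "P = (\<lambda>k l s. prob (starts s \<inter> types k l s))"
  define g where "g = 8 * ln (real n) / \<Delta>\<^sup>2 + 5"
  let ?h = "\<lambda>k l s \<omega>. indicator (starts s \<inter> types k l s) \<omega> * cost n k l s \<omega>"
  have h: "integrable M (?h k l s)" "expectation (?h k l s) \<le> P k l s * (if k = l then 2260 else g)"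
    if s: "1 \<le> s" and kl: "k \<in> {1, 2}" "l \<in> {1, 2}" for k l s
  proof -
    note c = cost[OF s kl, of n] and st = starts_types(1)[OF s kl]
    have ev: "starts s \<inter> types k l s \<in> events" using generated_events[OF present_sources(1)[OF s] st] .
    show "integrable M (?h k l s)"
      using integrable_real_mult_indicator[OF ev c(2)] by (simp add: mult.commute)
    have "expectation (?h k l s) = P k l s * expectation (cost n k l s)"
      unfolding P_def
      by (rule expectation_indicator_generated[OF present_sources(1)[OF s] future_subset[OF s] present_sources(2)[OF s] st c(1,2)])
    also have "\<dots> \<le> P k l s * (if k = l then 2260 else g)"
      using c(3) by (intro mult_left_mono) (auto simp: P_def g_def \<Delta>_def)
    finally show "expectation (?h k l s) \<le> P k l s * (if k = l then 2260 else g)" .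
  qed
  define S where "S = (\<Sum>s=1..<n. P 1 2 s + P 2 1 s)"
  have "expectation (\<lambda>\<omega>. \<Sum>t=1..n. of_bool (\<kappa> (play \<omega> t) \<omega> = 2))
      \<le> expectation (\<lambda>\<omega>. 1 + (\<Sum>s=1..<n. ?h 1 2 s \<omega> + ?h 2 1 s \<omega> + ?h 2 2 s \<omega>))"
  proof (rule integral_mono'[OF _ inferior_plays[OF _ n]])
    show "integrable M (\<lambda>\<omega>. 1 + (\<Sum>s=1..<n. ?h 1 2 s \<omega> + ?h 2 1 s \<omega> + ?h 2 2 s \<omega>))"
      using h(1) by (auto intro!: Bochner_Integration.integrable_add Bochner_Integration.integrable_sum)
    show "0 \<le> 1 + (\<Sum>s=1..<n. ?h 1 2 s \<omega> + ?h 2 1 s \<omega> + ?h 2 2 s \<omega>)" for \<omega>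
      using cost_nonneg[OF n] by (intro add_nonneg_nonneg sum_nonneg mult_nonneg_nonneg) auto
  qed
  also have "\<dots> = 1 + (\<Sum>s=1..<n. expectation (?h 1 2 s) + expectation (?h 2 1 s) + expectation (?h 2 2 s))"
  proof -
    define H where "H = (\<lambda>s \<omega>. ?h 1 2 s \<omega> + ?h 2 1 s \<omega> + ?h 2 2 s \<omega>)"
    have H: "integrable M (H s)" "expectation (H s) = expectation (?h 1 2 s) + expectation (?h 2 1 s) + expectation (?h 2 2 s)"
      if "s \<in> {1..<n}" for s
      using h(1)[of s 1 2] h(1)[of s 2 1] h(1)[of s 2 2] that by (simp_all add: H_def)
    have "expectation (\<lambda>\<omega>. 1 + (\<Sum>s=1..<n. H s \<omega>)) = expectation (\<lambda>\<omega>. 1) + expectation (\<lambda>\<omega>. \<Sum>s=1..<n. H s \<omega>)"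
      by (rule Bochner_Integration.integral_add) (use H(1) in auto)
    also have "expectation (\<lambda>\<omega>. \<Sum>s=1..<n. H s \<omega>) = (\<Sum>s=1..<n. expectation (H s))"
      by (rule Bochner_Integration.integral_sum) (rule H(1))
    finally have "expectation (\<lambda>\<omega>. 1 + (\<Sum>s=1..<n. H s \<omega>))
        = 1 + (\<Sum>s=1..<n. expectation (?h 1 2 s) + expectation (?h 2 1 s) + expectation (?h 2 2 s))"
      by (simp add: H(2) prob_space)
    then show ?thesis unfolding H_def .
  qed
  also have "\<dots> \<le> 1 + (\<Sum>s=1..<n. (P 1 2 s + P 2 1 s) * g + P 2 2 s * 2260)"
  proof (intro add_left_mono sum_mono)
    fix s assume "s \<in> {1..<n}"
    then show "expectation (?h 1 2 s) + expectation (?h 2 1 s) + expectation (?h 2 2 s)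
        \<le> (P 1 2 s + P 2 1 s) * g + P 2 2 s * 2260"
      using h(2)[of s 1 2] h(2)[of s 2 1] h(2)[of s 2 2] by (simp add: distrib_right)
  qed
  also have "\<dots> = 1 + S * g + 2260 * (\<Sum>s=1..<n. P 2 2 s)"
    by (simp add: S_def sum.distrib sum_distrib_left sum_distrib_right algebra_simps)
  finally have E: "expectation (\<lambda>\<omega>. \<Sum>t=1..n. of_bool (\<kappa> (play \<omega> t) \<omega> = 2)) \<le> 1 + S * g + 2260 * (\<Sum>s=1..<n. P 2 2 s)" .
  have \<alpha>: "0 \<le> \<alpha> n" "\<alpha> n \<le> 1" using reservoir_bounds[OF n] by auto
  have "\<alpha> n * (\<Sum>s=1..<n. P 2 2 s) \<le> S / 2"
    unfolding S_def sum_distrib_left sum_divide_distrib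
  proof (rule sum_mono)
    fix s assume s: "s \<in> {1..<n}"
    have "prob (starts s) * (\<alpha> n * (type_prob 2 s * type_prob 2 (Suc s)))
        \<le> prob (starts s) * ((type_prob 1 s * type_prob 2 (Suc s) + type_prob 2 s * type_prob 1 (Suc s)) / 2)"
      using reservoir_ratio[of s n] s by (intro mult_left_mono) auto
    then show "\<alpha> n * P 2 2 s \<le> (P 1 2 s + P 2 1 s) / 2"
      using s by (simp add: P_def starts_types(2) algebra_simps)
  qed
  have \<beta>: "0 < beta \<Delta>" using beta_pos by (simp add: \<Delta>_def)
  have \<Delta>: "0 < \<Delta>" using gap by (simp add: \<Delta>_def)
  have S: "0 \<le> S" "S \<le> 1 / beta \<Delta>"
  proof -
    show "0 \<le> S" unfolding S_def P_def by (intro sum_nonneg) auto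
    have "{1..<n} = {1..n - 1}" using n by auto
    then show "S \<le> 1 / beta \<Delta>"
      using sum_mixed_epochs[of "n - 1"] \<beta> by (simp add: S_def P_def \<Delta>_def field_simps)
  qed
  have g: "0 \<le> g" using n by (simp add: g_def)
  have "\<alpha> n * expectation (alg2_regret \<mu> \<kappa> Y Z U tie n)
      = \<Delta> * (\<alpha> n * expectation (\<lambda>\<omega>. \<Sum>t=1..n. of_bool (\<kappa> (play \<omega> t) \<omega> = 2)))"
    by (simp add: expected_regret \<Delta>_def)
  also have "\<dots> \<le> \<Delta> * (1 + g / beta \<Delta> + 1130 / beta \<Delta>)"
  proof (rule mult_left_mono)
    have "\<alpha> n * expectation (\<lambda>\<omega>. \<Sum>t=1..n. of_bool (\<kappa> (play \<omega> t) \<omega> = 2))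
        \<le> \<alpha> n * (1 + S * g + 2260 * (\<Sum>s=1..<n. P 2 2 s))"
      using E \<alpha> by (intro mult_left_mono) auto
    also have "\<dots> = \<alpha> n * (1 + S * g) + 2260 * (\<alpha> n * (\<Sum>s=1..<n. P 2 2 s))"
      by (simp add: distrib_left)
    \<comment> \<open>The factor \<open>\<alpha> n\<close> is spent on the pairs of inferior arms,
      turning their probabilities into \<open>S / 2\<close>; on the mixed part it is merely bounded
      by 1.\<close>
    also have "\<dots> \<le> 1 * (1 + S * g) + 2260 * (S / 2)"
    proof (rule add_mono)
      show "\<alpha> n * (1 + S * g) \<le> 1 * (1 + S * g)" using \<alpha> S g by (intro mult_right_mono) auto
    qed (use \<open>\<alpha> n * (\<Sum>s=1..<n. P 2 2 s) \<le> S / 2\<close> in linarith)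
    also have "\<dots> \<le> 1 + 1 / beta \<Delta> * g + 1130 * (1 / beta \<Delta>)"
    proof -
      have "S * g \<le> 1 / beta \<Delta> * g" using S g by (intro mult_right_mono) auto
      then show ?thesis using S by simp
    qed
    finally show "\<alpha> n * expectation (\<lambda>\<omega>. \<Sum>t=1..n. of_bool (\<kappa> (play \<omega> t) \<omega> = 2)) \<le> 1 + g / beta \<Delta> + 1130 / beta \<Delta>"
      by simp
  qed (use \<Delta> in simp)
  \<comment> \<open>The 5 in \<open>g\<close> joins \<open>1130 = 2260 / 2\<close>, and one power of
    the gap cancels in the logarithmic term.\<close>
  also have "\<dots> = 8 / (\<Delta> * beta \<Delta>) * ln (real n) + \<Delta> * (1 + 1135 / beta \<Delta>)"
    using \<Delta> \<beta> by (simp add: g_def field_simps power2_eq_square)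
  finally show ?thesis .
qed

end

theorem theorem3:
  fixes M :: "'a measure"
    and \<mu> \<alpha> :: "nat \<Rightarrow> real"
    and \<kappa> :: "nat \<Rightarrow> 'a \<Rightarrow> nat"
    and Y :: "nat \<Rightarrow> nat \<Rightarrow> nat \<Rightarrow> 'a \<Rightarrow> real"
    and Z :: "nat \<Rightarrow> 'a \<Rightarrow> real"
    and U :: "'a \<Rightarrow> real"
    and tie :: "nat \<Rightarrow> history \<Rightarrow> real \<Rightarrow> bool"
    and \<Delta> :: real
  assumes "alg2_bandit M \<mu> \<alpha> \<kappa> Y Z U tie"
    and "\<Delta> = \<mu> 1 - \<mu> 2"
  shows "limsup (\<lambda>n. ereal (\<alpha> n * (\<integral>\<omega>. alg2_regret \<mu> \<kappa> Y Z U tie n \<omega> \<partial>M) / ln (real n)))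
           \<le> ereal (8 / (\<Delta> * beta \<Delta>))"
proof -
  interpret alg2_bandit M \<mu> \<alpha> \<kappa> Y Z U tie by fact
  define a b where "a = 8 / (\<Delta> * beta \<Delta>)" and "b = \<Delta> * (1 + 1135 / beta \<Delta>)"
  have "eventually (\<lambda>n. ereal (\<alpha> n * (\<integral>\<omega>. alg2_regret \<mu> \<kappa> Y Z U tie n \<omega> \<partial>M) / ln (real n)) \<le> ereal (a + b / ln (real n))) sequentially"
    using eventually_ge_at_top[of 2]
  proof eventually_elim
    case (elim n)
    then have ln: "0 < ln (real n)" by simp
    have "\<alpha> n * (\<integral>\<omega>. alg2_regret \<mu> \<kappa> Y Z U tie n \<omega> \<partial>M) / ln (real n) \<le> (a * ln (real n) + b) / ln (real n)"
      using regret_bound[of n, folded assms(2), folded a_def b_def] elim ln by (intro divide_right_mono) auto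
    also have "\<dots> = a + b / ln (real n)" using ln by (simp add: add_divide_distrib)
    finally show ?case by simp
  qed
  then have "limsup (\<lambda>n. ereal (\<alpha> n * (\<integral>\<omega>. alg2_regret \<mu> \<kappa> Y Z U tie n \<omega> \<partial>M) / ln (real n)))
      \<le> limsup (\<lambda>n. ereal (a + b / ln (real n)))"
    by (rule Limsup_mono)
  also have "\<dots> = ereal a"
  proof (rule lim_imp_Limsup)
    have "(\<lambda>n. b / ln (real n)) \<longlonglongrightarrow> 0"
      by (rule real_tendsto_divide_at_top[OF tendsto_const filterlim_compose[OF ln_at_top filterlim_real_sequentially]])
    then have "(\<lambda>n. a + b / ln (real n)) \<longlonglongrightarrow> a" using tendsto_add[OF tendsto_const] by fastforce
    then show "(\<lambda>n. ereal (a + b / ln (real n))) \<longlonglongrightarrow> ereal a" by simp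
  qed simp
  finally show ?thesis by (simp add: a_def)
qed

end
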